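(* Let $\omega$ be a weight function with constants $K,b$, let $g\in\mathcal{S}_\omega(\mathbb{R}^N)$, $g\neq 0$, and let $1\le p\le\infty$. (i) For every $\lambda\ge 0$ and every $f\in\mathcal{S}_\omega(\mathbb{R}^N)$, $$\|e^{\lambda\omega}Sp_gf\|_\infty\le D_\lambda^{(1)}\,\|e^{2K^2\lambda\omega}Rf\|_{p}\,\|e^{2K^2\lambda\omega}Rg\|_{p'},\qquad D_\lambda^{(1)}=(2\pi)^{-N}e^{K(1+2K)\lambda}.$$ (ii) For every $\lambda\ge 0$, every $\mu>\frac{2N}{b(2p)'}$ and every $f\in\mathcal{S}_\omega(\mathbb{R}^N)$, $$\|e^{\lambda\omega}Rf\|_\infty\le D_{\lambda,\mu}^{(2)}\,\|e^{2(K^2\lambda+\mu)\omega}Sp_gf\|_p,$$ where $$D_{\lambda,\mu}^{(2)}=\frac{e^{K(1+2K)\lambda}\,\|e^{K^2\lambda\omega}g\|_\infty\,\|e^{K^2\lambda\omega}\hat g\|_\infty\,\|e^{-\mu\omega}\|^2_{L^{(2p)'}(\mathbb{R}^{2N})}}{(2\pi)^{2N}\|g\|_2^4}.$$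
   Context: A weight function is a continuous increasing (i.e. nondecreasing) function $\omega:[0,\infty)\to[0,\infty)$ such that: ($\alpha$) there is $K\ge1$ with $\omega(2t)\le K(1+\omega(t))$ for all $t\ge0$; ($\beta$) $\omega(t)=o(t)$ as $t\to\infty$; ($\gamma$) there are $a\in\mathbb{R}$, $b>0$ with $\omega(t)\ge a+b\log(1+t)$ for all $t\ge0$; ($\delta$) $t\mapsto\omega(e^t)$ is convex. $K$ and $b$ always denote the constants in ($\alpha$) and ($\gamma$). One extends $\omega$ to $\mathbb{R}^M$ by $\omega(z)=\omega(|z|)$; in particular $\omega(x,\xi)=\omega(|(x,\xi)|)$ on $\mathbb{R}^{2N}$. Fourier transform: $\hat f(\xi)=\int_{\mathbb{R}^N}e^{-ix\xi}f(x)\,dx$. $\mathcal{S}_\omega(\mathbb{R}^N)$ is the set of all $f\in L^1(\mathbb{R}^N)$ with $f,\hat f\in C^\infty(\mathbb{R}^N)$ and $\|e^{\lambda\omega}\partial^\alpha f\|_\infty<\infty$, $\|e^{\lambda\omega}\partial^\alpha\hat f\|_\infty<\infty$ for all $\lambda>0$, $\alpha\in\mathbb{N}_0^N$. Short-time Fourier transform: $V_gf(x,\xi)=\int_{\mathbb{R}^N}f(y)\overline{g(y-x)}e^{-iy\xi}\,dy$. Spectrogram: $Sp_gf(x,\xi)=|V_gf(x,\xi)|^2$. Rihaczek form: $Rf(x,\xi)=e^{-ix\xi}f(x)\overline{\hat f(\xi)}$, $(x,\xi)\in\mathbb{R}^{2N}$. $p'$ is the conjugate exponent of $p\in[1,\infty]$;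 $(2p)'$ is defined by $\frac1{2p}+\frac1{(2p)'}=1$, with $(2p)'=1$ for $p=\infty$. Norms of functions on $\mathbb{R}^N$ (such as $g,\hat g$) are in $L^q(\mathbb{R}^N)$, norms of functions on $\mathbb{R}^{2N}$ (such as $Sp_gf$, $Rf$) are in $L^q(\mathbb{R}^{2N})$. *)

theory Defs
  imports
    "HOL-Analysis.Analysis"
    "HOL-Library.Landau_Symbols"
    "HOL-Probability.Essential_Supremum"
begin

(* Only the values on [0,\<infinity>) matter; the constants K and b occur as parameters because
   the estimates depend on them. *)
definition weight_function :: "(real \<Rightarrow> real) \<Rightarrow> real \<Rightarrow> real \<Rightarrow> bool" where
  "weight_function \<omega> K b \<longleftrightarrow>
     continuous_on {0..} \<omega> \<and> mono_on {0..} \<omega> \<and> (\<forall>t\<ge>0. 0 \<le> \<omega> t) \<and>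
     1 \<le> K \<and> (\<forall>t\<ge>0. \<omega> (2 * t) \<le> K * (1 + \<omega> t)) \<and>
     \<omega> \<in> o[at_top](\<lambda>t. t) \<and>
     0 < b \<and> (\<exists>a. \<forall>t\<ge>0. a + b * ln (1 + t) \<le> \<omega> t) \<and>
     convex_on UNIV (\<lambda>t. \<omega> (exp t))"

(* Iterated partial derivatives are indexed by lists of coordinates instead of multi-indices:
   for a smooth f, iterated_partial is f is the derivative of multi-index
   \<alpha> = (\<lambda>i. count_list is i), and every multi-index arises from some list. *)
definition partial :: "'n::finite \<Rightarrow> (real^'n \<Rightarrow> complex) \<Rightarrow> real^'n \<Rightarrow> complex" where
  "partial i f x = vector_derivative (\<lambda>t. f (x + t *\<^sub>R axis i 1)) (at 0)"

definition iterated_partial :: "'n::finite list \<Rightarrow> (real^'n \<Rightarrow> complex) \<Rightarrow> real^'n \<Rightarrow> complex" where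
  "iterated_partial is f = foldr partial is f"

definition smooth :: "(real^'n::finite \<Rightarrow> complex) \<Rightarrow> bool" where
  "smooth f \<longleftrightarrow> (\<forall>is. continuous_on UNIV (iterated_partial is f) \<and>
     (\<forall>i x. (\<lambda>t. iterated_partial is f (x + t *\<^sub>R axis i 1)) differentiable (at 0)))"

definition fourier :: "(real^'n::finite \<Rightarrow> complex) \<Rightarrow> real^'n \<Rightarrow> complex" where
  "fourier f \<xi> = (LINT x|lborel. exp (- (\<i> * complex_of_real (x \<bullet> \<xi>))) * f x)"

(* Norms take values in [0,\<infinity>], so that they never silently default to 0;
   enn_powr is the power function for positive exponents r, with \<infinity> powr r = \<infinity>. *)
definition enn_powr :: "ennreal \<Rightarrow> real \<Rightarrow> ennreal" where
  "enn_powr u r = (if u = \<infinity> then \<infinity> else ennreal (enn2real u powr r))"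

definition Lp_norm :: "ennreal \<Rightarrow> ('a::euclidean_space \<Rightarrow> 'b::real_normed_vector) \<Rightarrow> ennreal" where
  "Lp_norm p f =
     (if p = \<infinity> then esssup lborel (\<lambda>x. ennreal (norm (f x)))
      else enn_powr (\<integral>\<^sup>+x. ennreal (norm (f x) powr enn2real p) \<partial>lborel) (1 / enn2real p))"

definition conj_exponent :: "ennreal \<Rightarrow> ennreal" where
  "conj_exponent p = inverse (1 - inverse p)"

lemma conj_exponent:
  assumes "1 \<le> p" shows "inverse p + inverse (conj_exponent p) = 1"
proof -
  have "inverse p \<le> 1"
    using assms by (cases p) (auto simp: inverse_ennreal ennreal_le_1 inverse_le_1_iff simp flip: ennreal_1)
  moreover have "inverse (inverse u) = u" for u :: ennreal
    by (cases u; cases "u = 0") (auto simp: inverse_ennreal less_le)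
  ultimately show ?thesis
    by (simp add: conj_exponent_def add_diff_inverse_ennreal)
qed

lemma conj_exponent_1: "conj_exponent 1 = \<infinity>"
  by (simp add: conj_exponent_def)

lemma conj_exponent_top: "conj_exponent \<infinity> = 1"
  by (simp add: conj_exponent_def)

definition S_omega :: "(real \<Rightarrow> real) \<Rightarrow> (real^'n::finite \<Rightarrow> complex) set" where
  "S_omega \<omega> = {f. integrable lborel f \<and> smooth f \<and> smooth (fourier f) \<and>
     (\<forall>lam>0. \<forall>is.
        Lp_norm \<infinity> (\<lambda>x. exp (lam * \<omega> (norm x)) *\<^sub>R iterated_partial is f x) < \<infinity> \<and>
        Lp_norm \<infinity> (\<lambda>x. exp (lam * \<omega> (norm x)) *\<^sub>R iterated_partial is (fourier f) x) < \<infinity>)}"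

(* Phase space R^{2N} is the product type, whose norm is the Euclidean one. *)
definition stft ::
  "(real^'n::finite \<Rightarrow> complex) \<Rightarrow> (real^'n \<Rightarrow> complex) \<Rightarrow> (real^'n) \<times> (real^'n) \<Rightarrow> complex" where
  "stft g f = (\<lambda>(x, \<xi>).
     LINT y|lborel. f y * cnj (g (y - x)) * exp (- (\<i> * complex_of_real (y \<bullet> \<xi>))))"

definition spectrogram ::
  "(real^'n::finite \<Rightarrow> complex) \<Rightarrow> (real^'n \<Rightarrow> complex) \<Rightarrow> (real^'n) \<times> (real^'n) \<Rightarrow> real" where
  "spectrogram g f z = (cmod (stft g f z))\<^sup>2"

definition rihaczek ::
  "(real^'n::finite \<Rightarrow> complex) \<Rightarrow> (real^'n) \<times> (real^'n) \<Rightarrow> complex" where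
  "rihaczek f = (\<lambda>(x, \<xi>).
     exp (- (\<i> * complex_of_real (x \<bullet> \<xi>))) * f x * cnj (fourier f \<xi>))"

end

theory Submission
  imports Defs "HOL-Probability.Characteristic_Functions" "HOL-Probability.Sinc_Integral"
begin

text \<open>
  Both estimates rest on the identity
  \<open>V\<^sub>G F (\<xi>, -x) = (2 \<pi>)\<^sup>N exp (i x \<xi>) V\<^sub>g f (x, \<xi>)\<close>, where \<open>F\<close> and \<open>G\<close> are the Fourier transforms of \<open>f\<close> and \<open>g\<close>.
  Estimating one factor of \<open>|V\<^sub>g f|\<^sup>2\<close> by its definition and the other by this identity bounds the spectrogram
  by the convolution of \<open>|Rf|\<close> with the reflection of \<open>|Rg|\<close>, and (i) follows from Hoelder's inequality.
  For (ii), Fourier inversion in the second variable gives \<open>(2 \<pi>)\<^sup>N |f(x)| |g(x - y)| \<le> \<integral> |V\<^sub>g f (y, \<eta>)| d\<eta>\<close>;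
  multiplying by \<open>|g(x - y)|\<close> and integrating over \<open>y\<close> bounds \<open>|f(x)| \<parallel>g\<parallel>\<^sup>2\<close>, and the same argument for
  \<open>F\<close> and \<open>G\<close> bounds \<open>|F(\<xi>)| \<parallel>g\<parallel>\<^sup>2\<close>. The weights are distributed by
  \<open>\<omega>(s + t) \<le> K (1 + \<omega>(s) + \<omega>(t))\<close>.
\<close>

section \<open>Fourier inversion\<close>

lemma nn_integral_lborel_affine:
  fixes t :: "'a::euclidean_space"
  assumes [measurable]: "f \<in> borel_measurable borel" and c: "c \<noteq> 0"
  shows "(\<integral>\<^sup>+x. f x \<partial>lborel) = ennreal (\<bar>c\<bar> ^ DIM('a)) * (\<integral>\<^sup>+x. f (t + c *\<^sub>R x) \<partial>lborel)"
  by (subst lborel_affine[OF c, of t])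
     (simp add: nn_integral_density nn_integral_distr nn_integral_cmult ennreal_power)

lemma integrable_lborel_affine:
  fixes f :: "'a::euclidean_space \<Rightarrow> 'b::{banach, second_countable_topology}"
  assumes f: "integrable lborel f" and c: "c \<noteq> 0"
  shows "integrable lborel (\<lambda>x. f (t + c *\<^sub>R x))"
proof -
  have [measurable]: "f \<in> borel_measurable borel"
    using borel_measurable_integrable[OF f] by simp
  have "ennreal (\<bar>c\<bar> ^ DIM('a)) * (\<integral>\<^sup>+x. norm (f (t + c *\<^sub>R x)) \<partial>lborel) < \<infinity>"
    using f by (subst nn_integral_lborel_affine[OF _ c, symmetric]) (simp_all add: integrable_iff_bounded)
  then show ?thesis
    using c by (auto simp: integrable_iff_bounded ennreal_mult_less_top)
qed

lemma integral_lborel_affine: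
  fixes f :: "'a::euclidean_space \<Rightarrow> 'b::{banach, second_countable_topology}"
  assumes [measurable]: "f \<in> borel_measurable borel" and c: "c \<noteq> 0"
  shows "(\<integral>x. f x \<partial>lborel) = \<bar>c\<bar> ^ DIM('a) *\<^sub>R (\<integral>x. f (t + c *\<^sub>R x) \<partial>lborel)"
  by (subst lborel_affine[OF c, of t])
     (simp add: integral_density integral_distr)

text \<open>\<open>lborel\<close> is the image of the finite product of one-dimensional Lebesgue
  measures over \<open>Basis\<close>, so Fubini applies coordinate by coordinate. This carries the
  one-dimensional facts about the normal density and about \<open>inverse (1 + x\<^sup>2)\<close>
  over to higher dimension.\<close>

lemma integral_lborel_prod:
  fixes f :: "'a::euclidean_space \<Rightarrow> real \<Rightarrow> 'b::{real_normed_field, banach, second_countable_topology}"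
  assumes f: "\<And>b. b \<in> Basis \<Longrightarrow> integrable lborel (f b)"
  shows "integrable lborel (\<lambda>x. \<Prod>b\<in>Basis. f b (x \<bullet> b))"
    and "(\<integral>x. (\<Prod>b\<in>Basis. f b (x \<bullet> b)) \<partial>lborel) = (\<Prod>b\<in>Basis. \<integral>x. f b x \<partial>lborel)"
proof -
  interpret product_sigma_finite "\<lambda>_::'a. lborel :: real measure" ..
  have [measurable]: "f b \<in> borel_measurable borel" if "b \<in> Basis" for b
    using borel_measurable_integrable[OF f[OF that]] by simp
  have eq: "(\<Prod>b\<in>Basis. f b ((\<Sum>d\<in>Basis. x d *\<^sub>R d) \<bullet> b)) = (\<Prod>b\<in>Basis. f b (x b))" for x
    by (intro prod.cong) (simp_all add: inner_sum_left_Basis)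
  show "integrable lborel (\<lambda>x. \<Prod>b\<in>Basis. f b (x \<bullet> b))"
    unfolding lborel_eq[where 'a='a]
    by (subst integrable_distr_eq) (use product_integrable_prod[OF finite_Basis f] in \<open>simp_all add: eq\<close>)
  show "(\<integral>x. (\<Prod>b\<in>Basis. f b (x \<bullet> b)) \<partial>lborel) = (\<Prod>b\<in>Basis. \<integral>x. f b x \<partial>lborel)"
    unfolding lborel_eq[where 'a='a]
    by (subst integral_distr) (use product_integral_prod[OF finite_Basis f] in \<open>simp_all add: eq\<close>)
qed

section \<open>The Gaussian and its Fourier transform\<close>

text \<open>Scaled to be 1 at the origin, so that \<open>gauss (e *\<^sub>R x)\<close> increases to
  1 as \<open>e\<close> decreases to 0 and can serve as a convergence factor.\<close>

definition gauss :: "'a::euclidean_space \<Rightarrow> real" where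
  "gauss x = exp (- (norm x)\<^sup>2 / 2)"

lemma gauss_measurable [measurable]: "gauss \<in> borel_measurable borel"
  unfolding gauss_def[abs_def] by measurable

lemma gauss_bounds: "0 < gauss x" "gauss x \<le> 1"
  by (simp_all add: gauss_def)

lemma gauss_eq_prod: "gauss x = (\<Prod>b\<in>Basis. sqrt (2 * pi) * std_normal_density (x \<bullet> b))"
proof -
  have "(norm x)\<^sup>2 = (\<Sum>b\<in>Basis. (x \<bullet> b)\<^sup>2)"
    by (simp add: norm_eq_sqrt_inner euclidean_inner[of x x] sum_nonneg power2_eq_square)
  then show ?thesis
    by (simp add: gauss_def std_normal_density_def sum_divide_distrib flip: exp_sum sum_negf)
qed

lemma integrable_std_normal_density: "integrable lborel std_normal_density"
  using integrable_std_normal_moment[of 0] by simp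

lemma integrable_gauss: "integrable lborel (gauss :: 'a::euclidean_space \<Rightarrow> real)"
  unfolding gauss_eq_prod[abs_def]
  by (rule integral_lborel_prod) (simp add: integrable_std_normal_density)

text \<open>The integral is the characteristic function of the standard normal distribution at
  \<open>- t\<close>.\<close>

lemma integral_std_normal_iexp:
  "(\<integral>x. complex_of_real (std_normal_density x) * exp (- (\<i> * complex_of_real (x * t))) \<partial>lborel)
    = complex_of_real (exp (- t\<^sup>2 / 2))"
proof -
  have "char std_normal_distribution (- t) =
     (\<integral>x. complex_of_real (std_normal_density x) * exp (- (\<i> * complex_of_real (x * t))) \<partial>lborel)"
    unfolding char_def by (subst integral_density) (auto simp: scaleR_conv_of_real mult_ac)
  then show ?thesis
    by (simp add: char_std_normal_distribution)
qed

text \<open>Gaussian and exponential kernel both factor over the coordinates, which reduces the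
  claim to one dimension. Each coordinate contributes one factor \<open>sqrt (2 * pi)\<close>, the
  normalisation of the density.\<close>

lemma fourier_gauss:
  fixes \<xi> :: "real^'n"
  shows "fourier (\<lambda>x. complex_of_real (gauss x)) \<xi> = complex_of_real (sqrt (2 * pi) ^ CARD('n) * gauss \<xi>)"
proof -
  let ?h = "\<lambda>b x. complex_of_real (sqrt (2 * pi)) *
     (complex_of_real (std_normal_density x) * exp (- (\<i> * complex_of_real (x * (\<xi> \<bullet> b)))))"
  have int: "integrable lborel (?h b)" for b
  proof (rule Bochner_Integration.integrable_bound[of _ "\<lambda>x. sqrt (2 * pi) * std_normal_density x"])
    show "AE x in lborel. norm (?h b x) \<le> norm (sqrt (2 * pi) * std_normal_density x)"
      by (simp add: norm_mult)
  qed (simp_all add: integrable_std_normal_density)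
  have "exp (- (\<i> * complex_of_real (x \<bullet> \<xi>))) * complex_of_real (gauss x) = (\<Prod>b\<in>Basis. ?h b (x \<bullet> b))" for x
  proof -
    have "exp (- (\<i> * complex_of_real (x \<bullet> \<xi>))) = (\<Prod>b\<in>Basis. exp (- (\<i> * complex_of_real ((x \<bullet> b) * (\<xi> \<bullet> b)))))"
      by (subst euclidean_inner) (simp add: sum_distrib_left flip: exp_sum sum_negf)
    then show ?thesis
      by (simp add: gauss_eq_prod prod.distrib mult_ac)
  qed
  then have "fourier (\<lambda>x. complex_of_real (gauss x)) \<xi> = (\<Prod>b\<in>Basis. \<integral>x. ?h b x \<partial>lborel)"
    unfolding fourier_def by (simp only: integral_lborel_prod(2)[OF int])
  also have "\<dots> = (\<Prod>b\<in>Basis. complex_of_real (sqrt (2 * pi) * exp (- (\<xi> \<bullet> b)\<^sup>2 / 2)))"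
    by (simp add: integral_std_normal_iexp[unfolded of_real_mult])
  also have "\<dots> = complex_of_real (\<Prod>b\<in>Basis. sqrt (2 * pi) * (sqrt (2 * pi) * std_normal_density (\<xi> \<bullet> b)))"
    by (simp add: std_normal_density_def)
  also have "\<dots> = complex_of_real (sqrt (2 * pi) ^ CARD('n) * gauss \<xi>)"
    by (subst prod.distrib) (simp add: gauss_eq_prod)
  finally show ?thesis .
qed

text \<open>This is the value of the Fourier transform at 0.\<close>

lemma integral_gauss: "(\<integral>x. gauss (x::real^'n) \<partial>lborel) = sqrt (2 * pi) ^ CARD('n)"
proof -
  have "complex_of_real (\<integral>x. gauss (x::real^'n) \<partial>lborel) = complex_of_real (sqrt (2 * pi) ^ CARD('n))"
    using fourier_gauss[of "0::real^'n"] by (simp add: fourier_def gauss_def)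
  then show ?thesis
    using of_real_eq_iff by blast
qed

section \<open>Inversion by Gaussian regularisation\<close>

text \<open>The product of \<open>f\<close> and \<open>h\<close> is integrable on the product space
  and dominates the integrand. The kernels inserted later are products of unimodular
  exponentials.\<close>

lemma Fubini_kernel:
  fixes f :: "'a::euclidean_space \<Rightarrow> complex" and h :: "'b::euclidean_space \<Rightarrow> complex"
  assumes f: "integrable lborel f" and h: "integrable lborel h"
    and k: "(\<lambda>(x, y). k x y) \<in> borel_measurable (borel \<Otimes>\<^sub>M borel)" "\<And>x y. cmod (k x y) \<le> 1"
  shows "(\<integral>x. f x * (\<integral>y. h y * k x y \<partial>lborel) \<partial>lborel) = (\<integral>y. h y * (\<integral>x. f x * k x y \<partial>lborel) \<partial>lborel)"
proof -
  have [measurable]: "f \<in> borel_measurable borel" "h \<in> borel_measurable borel"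
    using f h borel_measurable_integrable by force+
  note [measurable] = k(1)
  let ?F = "\<lambda>x y. f x * h y * k x y"
  have "integrable (lborel \<Otimes>\<^sub>M lborel) (\<lambda>(x, y). ?F x y)"
  proof (rule Bochner_Integration.integrable_bound)
    show "integrable (lborel \<Otimes>\<^sub>M lborel) (\<lambda>(x, y). f x * h y)"
    proof (rule lborel_pair.Fubini_integrable)
      show "integrable lborel (\<lambda>x. \<integral>y. norm (case (x, y) of (x, y) \<Rightarrow> f x * h y) \<partial>lborel)"
        using f h by (simp add: norm_mult)
      show "AE x in lborel. integrable lborel (\<lambda>y. case (x, y) of (x, y) \<Rightarrow> f x * h y)"
        using h by simp
    qed measurable
    show "AE z in lborel \<Otimes>\<^sub>M lborel. norm (case z of (x, y) \<Rightarrow> ?F x y) \<le> norm (case z of (x, y) \<Rightarrow> f x * h y)"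
      by (auto simp: norm_mult mult_left_le k(2))
  qed measurable
  then have "(\<integral>y. (\<integral>x. ?F x y \<partial>lborel) \<partial>lborel) = (\<integral>x. (\<integral>y. ?F x y \<partial>lborel) \<partial>lborel)"
    by (rule lborel_pair.Fubini_integral)
  moreover have "(\<integral>y. ?F x y \<partial>lborel) = f x * (\<integral>y. h y * k x y \<partial>lborel)" for x
    by (simp only: mult.assoc integral_mult_right_zero)
  moreover have "(\<integral>x. ?F x y \<partial>lborel) = h y * (\<integral>x. f x * k x y \<partial>lborel)" for y
    by (simp only: mult.assoc mult.left_commute[of _ "h y"] integral_mult_right_zero)
  ultimately show ?thesis by simp
qed


lemma cmod_exp_i [simp]: "cmod (exp (\<i> * complex_of_real t)) = 1" "cmod (exp (- (\<i> * complex_of_real t))) = 1"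
  by (simp_all add: norm_exp_eq_Re)

lemma integrable_phase:
  fixes f :: "'a::euclidean_space \<Rightarrow> complex"
  assumes f: "integrable lborel f" and [measurable]: "u \<in> borel_measurable borel" and u: "\<And>x. cmod (u x) \<le> 1"
  shows "integrable lborel (\<lambda>x. u x * f x)"
proof (rule Bochner_Integration.integrable_bound[OF f])
  show "(\<lambda>x. u x * f x) \<in> borel_measurable lborel"
    using borel_measurable_integrable[OF f] by measurable
  show "AE x in lborel. norm (u x * f x) \<le> norm (f x)"
    by (simp add: norm_mult mult_left_le_one_le u)
qed

lemma cmod_fourier_le:
  assumes f: "integrable lborel f"
  shows "cmod (fourier f \<xi>) \<le> (\<integral>x. cmod (f x) \<partial>lborel)"
proof -
  have "cmod (fourier f \<xi>) \<le> (\<integral>x. cmod (exp (- (\<i> * complex_of_real (x \<bullet> \<xi>))) * f x) \<partial>lborel)"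
    unfolding fourier_def by (rule integral_norm_bound)
  then show ?thesis by (simp add: norm_mult)
qed

text \<open>Fubini moves the Fourier transform from \<open>f\<close> to the Gaussian factor, whose
  transform is known; the substitution \<open>y = x + e *\<^sub>R u\<close> then gives an average of
  \<open>f\<close> near \<open>x\<close>. Only integrability of \<open>f\<close> enters
  here.\<close>

lemma integral_fourier_gauss:
  fixes f :: "real^'n::finite \<Rightarrow> complex"
  assumes f: "integrable lborel f" and e: "e > 0"
  shows "(\<integral>\<eta>. fourier f \<eta> * (complex_of_real (gauss (e *\<^sub>R \<eta>)) * exp (\<i> * complex_of_real (x \<bullet> \<eta>))) \<partial>lborel)
     = complex_of_real (sqrt (2 * pi) ^ CARD('n)) * (\<integral>u. f (x + e *\<^sub>R u) * complex_of_real (gauss u) \<partial>lborel)"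
    (is "?L = ?s * ?R")
proof -
  have [measurable]: "f \<in> borel_measurable borel"
    using borel_measurable_integrable[OF f] by simp
  have dim: "DIM(real^'n) = CARD('n)" by simp
  have ge: "integrable lborel (\<lambda>\<eta>::real^'n. complex_of_real (gauss (e *\<^sub>R \<eta>)))"
    using integrable_lborel_affine[OF integrable_of_real[OF integrable_gauss], of e 0] e by simp
  have h: "integrable lborel (\<lambda>\<eta>. complex_of_real (gauss (e *\<^sub>R \<eta>)) * exp (\<i> * complex_of_real (x \<bullet> \<eta>)))"
    using integrable_phase[OF ge, of "\<lambda>\<eta>. exp (\<i> * complex_of_real (x \<bullet> \<eta>))"] by (simp add: mult.commute)
  let ?h = "\<lambda>\<eta>. complex_of_real (gauss (e *\<^sub>R \<eta>)) * exp (\<i> * complex_of_real (x \<bullet> \<eta>))"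
  have "?L = (\<integral>\<eta>. ?h \<eta> * (\<integral>y. f y * exp (- (\<i> * complex_of_real (y \<bullet> \<eta>))) \<partial>lborel) \<partial>lborel)"
    by (simp add: fourier_def mult.commute)
  also have "\<dots> = (\<integral>y. f y * (\<integral>\<eta>. ?h \<eta> * exp (- (\<i> * complex_of_real (y \<bullet> \<eta>))) \<partial>lborel) \<partial>lborel)"
    by (rule Fubini_kernel[OF h f]) simp_all
  also have "\<dots> = (\<integral>y. f y * (?s * complex_of_real (gauss ((y - x) /\<^sub>R e) / e ^ CARD('n))) \<partial>lborel)"
  proof (intro Bochner_Integration.integral_cong refl arg_cong2[where f="(*)"])
    fix y
    \<comment> \<open>In the variable \<open>e *\<^sub>R \<eta>\<close> the inner integral becomes
      the transform of \<open>gauss\<close> at \<open>(y - x) /\<^sub>R e\<close>. The resulting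
      factor \<open>1 / e ^ CARD('n)\<close> is cancelled by the later substitution in
      \<open>y\<close>.\<close>
    let ?k = "\<lambda>\<eta>. complex_of_real (gauss \<eta>) * exp (- (\<i> * complex_of_real (((y - x) /\<^sub>R e) \<bullet> \<eta>)))"
    have eq: "?h \<eta> * exp (- (\<i> * complex_of_real (y \<bullet> \<eta>))) = ?k (0 + e *\<^sub>R \<eta>)" for \<eta>
    proof -
      have "((y - x) /\<^sub>R e) \<bullet> (0 + e *\<^sub>R \<eta>) = y \<bullet> \<eta> - x \<bullet> \<eta>"
        using e by (simp add: inner_diff_left)
      then show ?thesis
        by (simp only:) (simp add: algebra_simps flip: exp_add)
    qed
    have "e ^ CARD('n) *\<^sub>R (\<integral>\<eta>. ?k (0 + e *\<^sub>R \<eta>) \<partial>lborel) = (\<integral>\<eta>. ?k \<eta> \<partial>lborel)"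
      using e by (subst (2) integral_lborel_affine[of _ e 0]) (simp_all only: dim, simp_all)
    also have "\<dots> = ?s * complex_of_real (gauss ((y - x) /\<^sub>R e))"
      using fourier_gauss[of "(y - x) /\<^sub>R e"] by (simp add: fourier_def mult.commute inner_commute)
    finally show "(\<integral>\<eta>. ?h \<eta> * exp (- (\<i> * complex_of_real (y \<bullet> \<eta>))) \<partial>lborel) =
        ?s * complex_of_real (gauss ((y - x) /\<^sub>R e) / e ^ CARD('n))"
      unfolding eq using e by (simp add: scaleR_conv_of_real field_simps)
  qed
  also have "\<dots> = e ^ CARD('n) *\<^sub>R (\<integral>u. f (x + e *\<^sub>R u) *
      (?s * complex_of_real (gauss ((x + e *\<^sub>R u - x) /\<^sub>R e) / e ^ CARD('n))) \<partial>lborel)"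
  proof -
    have "(\<lambda>y. f y * (?s * complex_of_real (gauss ((y - x) /\<^sub>R e) / e ^ CARD('n)))) \<in> borel_measurable borel"
      by measurable
    moreover have "e \<noteq> 0" using e by simp
    ultimately show ?thesis
      by (subst integral_lborel_affine[where c = e and t = x]) (simp_all only: dim abs_of_pos[OF e] not_False_eq_True)
  qed
  also have "\<dots> = (\<integral>u. e ^ CARD('n) *\<^sub>R (f (x + e *\<^sub>R u) *
      (?s * complex_of_real (gauss ((x + e *\<^sub>R u - x) /\<^sub>R e) / e ^ CARD('n)))) \<partial>lborel)"
    by (rule integral_scaleR_right[symmetric])
  also have "\<dots> = (\<integral>u. ?s * (f (x + e *\<^sub>R u) * complex_of_real (gauss u)) \<partial>lborel)"
  proof (intro Bochner_Integration.integral_cong refl)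
    fix u
    have *: "(x + e *\<^sub>R u - x) /\<^sub>R e = u"
      using e by simp
    show "e ^ CARD('n) *\<^sub>R (f (x + e *\<^sub>R u) *
      (?s * complex_of_real (gauss ((x + e *\<^sub>R u - x) /\<^sub>R e) / e ^ CARD('n)))) = ?s * (f (x + e *\<^sub>R u) * complex_of_real (gauss u))"
      unfolding * using e by (simp add: scaleR_conv_of_real del: of_real_power)
  qed
  also have "\<dots> = ?s * ?R"
    by (rule integral_mult_right_zero)
  finally show ?thesis .
qed

text \<open>Let the scale tend to 0 on both sides of the regularised formula. Dominated convergence
  applies with majorant \<open>cmod (fourier f \<eta>)\<close> on the left and
  \<open>B * gauss u\<close> on the right, where continuity of \<open>f\<close> at \<open>x\<close>
  gives the pointwise limit. One half of the constant comes from the formula, the other from the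
  integral of the Gaussian.\<close>

lemma fourier_inversion:
  fixes f :: "real^'n::finite \<Rightarrow> complex"
  assumes int: "integrable lborel f" "integrable lborel (fourier f)"
    and cont: "continuous_on UNIV f" and bdd: "bounded (range f)"
  shows "(\<integral>\<eta>. fourier f \<eta> * exp (\<i> * complex_of_real (x \<bullet> \<eta>)) \<partial>lborel) = (2 * pi) ^ CARD('n) * f x"
proof -
  define e where "e = (\<lambda>n. 1 / real (Suc n))"
  have e0: "e n > 0" for n by (simp add: e_def)
  have e: "e \<longlonglongrightarrow> 0" unfolding e_def by (rule LIMSEQ_Suc) (rule lim_1_over_n)
  have [measurable]: "f \<in> borel_measurable borel" "fourier f \<in> borel_measurable borel"
    using int borel_measurable_integrable by force+
  obtain B where B: "\<And>x. cmod (f x) \<le> B"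
    using bdd by (auto simp: bounded_iff)
  let ?E = "\<lambda>\<eta>. exp (\<i> * complex_of_real (x \<bullet> \<eta>))"
  let ?s = "complex_of_real (sqrt (2 * pi) ^ CARD('n))"
  have ge: "(\<lambda>n. complex_of_real (gauss (e n *\<^sub>R \<eta>))) \<longlonglongrightarrow> 1" for \<eta> :: "real^'n"
  proof -
    have "(\<lambda>n. complex_of_real (gauss (e n *\<^sub>R \<eta>))) \<longlonglongrightarrow> complex_of_real (exp (- (norm (0 *\<^sub>R \<eta>))\<^sup>2 / 2))"
      unfolding gauss_def by (intro tendsto_intros e)  simp
    then show ?thesis by simp
  qed
  have "(\<lambda>n. \<integral>\<eta>. fourier f \<eta> * (complex_of_real (gauss (e n *\<^sub>R \<eta>)) * ?E \<eta>) \<partial>lborel)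
      \<longlonglongrightarrow> (\<integral>\<eta>. fourier f \<eta> * (1 * ?E \<eta>) \<partial>lborel)"
  proof (rule integral_dominated_convergence[where w="\<lambda>\<eta>. cmod (fourier f \<eta>)"])
    show "AE \<eta> in lborel. (\<lambda>n. fourier f \<eta> * (complex_of_real (gauss (e n *\<^sub>R \<eta>)) * ?E \<eta>))
        \<longlonglongrightarrow> fourier f \<eta> * (1 * ?E \<eta>)"
      by (intro AE_I2 tendsto_intros ge)
    show "AE \<eta> in lborel. cmod (fourier f \<eta> * (complex_of_real (gauss (e n *\<^sub>R \<eta>)) * ?E \<eta>)) \<le> cmod (fourier f \<eta>)" for n
      by (simp add: norm_mult mult_left_le abs_of_pos gauss_bounds)
  qed (use int in simp_all)
  moreover have "(\<lambda>n. ?s * (\<integral>u. f (x + e n *\<^sub>R u) * complex_of_real (gauss u) \<partial>lborel))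
      \<longlonglongrightarrow> ?s * (\<integral>u. f x * complex_of_real (gauss (u::real^'n)) \<partial>lborel)"
  proof (intro tendsto_mult tendsto_const integral_dominated_convergence[where w="\<lambda>u. B * gauss u"])
    show "AE u in lborel. (\<lambda>n. f (x + e n *\<^sub>R u) * complex_of_real (gauss u)) \<longlonglongrightarrow> f x * complex_of_real (gauss u)"
    proof (intro AE_I2 tendsto_mult tendsto_const)
      fix u :: "real^'n"
      have "(\<lambda>n. x + e n *\<^sub>R u) \<longlonglongrightarrow> x + 0 *\<^sub>R u"
        by (intro tendsto_intros e)
      then show "(\<lambda>n. f (x + e n *\<^sub>R u)) \<longlonglongrightarrow> f x"
        using cont by (auto simp: continuous_on_eq_continuous_at isCont_def intro: isCont_tendsto_compose)
    qed
    show "AE u in lborel. cmod (f (x + e n *\<^sub>R u) * complex_of_real (gauss u)) \<le> B * gauss u" for n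
      by (simp add: norm_mult mult_right_mono B abs_of_pos gauss_bounds less_imp_le[OF gauss_bounds(1)])
  qed (simp_all add: integrable_gauss)
  ultimately have "(\<integral>\<eta>. fourier f \<eta> * (1 * ?E \<eta>) \<partial>lborel) = ?s * (\<integral>u. f x * complex_of_real (gauss (u::real^'n)) \<partial>lborel)"
    by (simp only: integral_fourier_gauss[OF int(1) e0]) (rule LIMSEQ_unique)
  also have "\<dots> = ?s * ?s * f x"
    by (simp add: integral_gauss)
  also have "?s * ?s = complex_of_real ((sqrt (2 * pi) * sqrt (2 * pi)) ^ CARD('n))"
    by (simp only: of_real_mult of_real_power power_mult_distrib)
  also have "\<dots> = complex_of_real ((2 * pi) ^ CARD('n))"
    by (simp only: real_sqrt_mult_self) simp
  finally show ?thesis by simp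
qed

section \<open>A class of functions closed under the Fourier transform\<close>

text \<open>The setting for all unweighted estimates. Boundedness of \<open>fourier f\<close> is not
  listed because it follows from integrability of \<open>f\<close>.\<close>

definition fourier_invertible :: "(real^'n::finite \<Rightarrow> complex) \<Rightarrow> bool" where
  "fourier_invertible f \<longleftrightarrow> integrable lborel f \<and> continuous_on UNIV f \<and> bounded (range f) \<and>
     integrable lborel (fourier f) \<and> continuous_on UNIV (fourier f)"

lemma fourier_fourier:
  fixes f :: "real^'n::finite \<Rightarrow> complex"
  assumes "fourier_invertible f"
  shows "fourier (fourier f) x = (2 * pi) ^ CARD('n) * f (- x)"
  using assms fourier_inversion[of f "- x"] by (simp add: fourier_invertible_def fourier_def mult.commute inner_commute)

text \<open>By inversion the second transform is a multiple of the reflection of \<open>f\<close>,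
  so the properties of \<open>f\<close> become those of \<open>fourier (fourier f)\<close>.\<close>

lemma fourier_invertible_fourier:
  fixes f :: "real^'n::finite \<Rightarrow> complex"
  assumes f: "fourier_invertible f"
  shows "fourier_invertible (fourier f)"
proof -
  have "bounded (range (fourier f))"
    using cmod_fourier_le f by (auto simp: bounded_iff fourier_invertible_def)
  moreover have "integrable lborel (\<lambda>x. f (0 + (- 1) *\<^sub>R x))"
    using f unfolding fourier_invertible_def by (intro integrable_lborel_affine) auto
  moreover have "continuous_on UNIV (\<lambda>x. f (- x))"
    using f unfolding fourier_invertible_def by (auto intro!: continuous_on_compose2[of UNIV f] continuous_intros)
  ultimately show ?thesis
    using f by (auto simp: fourier_invertible_def fourier_fourier[OF f, abs_def] intro!: continuous_intros)
qed

section \<open>The short-time Fourier transform\<close>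

text \<open>Without integrability the Bochner integral is 0 by convention, and the bound is
  trivial.\<close>

lemma norm_integral_le_nn_integral:
  fixes f :: "'a \<Rightarrow> 'b::{banach, second_countable_topology}"
  shows "ennreal (norm (integral\<^sup>L M f)) \<le> (\<integral>\<^sup>+x. norm (f x) \<partial>M)"
  by (cases "integrable M f") (simp_all add: integral_norm_bound_ennreal not_integrable_integral_eq)

lemma nn_integral_lborel_times:
  fixes a :: "'a::euclidean_space \<Rightarrow> ennreal" and b :: "'b::euclidean_space \<Rightarrow> ennreal"
  assumes [measurable]: "a \<in> borel_measurable borel" "b \<in> borel_measurable borel"
  shows "(\<integral>\<^sup>+z. a (fst z) * b (snd z) \<partial>lborel) = (\<integral>\<^sup>+x. a x \<partial>lborel) * (\<integral>\<^sup>+y. b y \<partial>lborel)"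
proof -
  have "(\<integral>\<^sup>+z. a (fst z) * b (snd z) \<partial>lborel) = (\<integral>\<^sup>+z. a (fst z) * b (snd z) \<partial>(lborel \<Otimes>\<^sub>M lborel))"
    by (simp add: lborel_prod)
  also have "\<dots> = (\<integral>\<^sup>+x. \<integral>\<^sup>+y. a x * b y \<partial>lborel \<partial>lborel)"
    by (subst lborel.nn_integral_fst[symmetric]) simp_all
  also have "\<dots> = (\<integral>\<^sup>+x. a x \<partial>lborel) * (\<integral>\<^sup>+y. b y \<partial>lborel)"
    by (simp add: nn_integral_cmult nn_integral_multc)
  finally show ?thesis .
qed

lemma fourier_invertibleD:
  assumes "fourier_invertible f"
  shows "integrable lborel f" "integrable lborel (fourier f)" "continuous_on UNIV f" "bounded (range f)"
    "f \<in> borel_measurable borel" "fourier f \<in> borel_measurable borel"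
  using assms by (auto simp: fourier_invertible_def borel_measurable_continuous_onI)

text \<open>Makes inversion available for the slices of the short-time Fourier transform at fixed
  \<open>x\<close>.\<close>

lemma stft_eq_fourier: "stft g f (x, \<xi>) = fourier (\<lambda>y. f y * cnj (g (y - x))) \<xi>"
  by (simp add: stft_def fourier_def mult_ac)

lemma borel_measurable_cnj [measurable (raw)]:
  "f \<in> borel_measurable M \<Longrightarrow> (\<lambda>x. cnj (f x)) \<in> borel_measurable M"
  by (rule borel_measurable_continuous_on) (auto intro: continuous_intros)

lemma stft_measurable [measurable]:
  fixes f g :: "real^'n::finite \<Rightarrow> complex"
  assumes [measurable]: "f \<in> borel_measurable borel" "g \<in> borel_measurable borel"
  shows "stft g f \<in> borel_measurable (borel \<Otimes>\<^sub>M borel)" "stft g f \<in> borel_measurable borel"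
proof -
  have "stft g f = (\<lambda>z. \<integral>y. f y * cnj (g (y - fst z)) * exp (- (\<i> * complex_of_real (y \<bullet> snd z))) \<partial>lborel)"
    by (simp add: fun_eq_iff stft_def)
  also have "\<dots> \<in> borel_measurable (borel \<Otimes>\<^sub>M borel)"
    by measurable
  finally show "stft g f \<in> borel_measurable (borel \<Otimes>\<^sub>M borel)" .
  then show "stft g f \<in> borel_measurable borel"
    by (simp add: borel_prod)
qed

section \<open>Passing to the transforms, and the upper bound for the spectrogram\<close>

text \<open>Write the conjugate of \<open>fourier g\<close> as an integral over \<open>t\<close> and
  exchange the integrals. The inner integral over \<eta> is then inversion of \<open>f\<close> at
  \<open>t + x\<close>, and the substitution \<open>y = t + x\<close> produces the transform of the
  pair \<open>f\<close>, \<open>g\<close>.\<close>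

lemma stft_fourier:
  fixes f g :: "real^'n::finite \<Rightarrow> complex"
  assumes f: "fourier_invertible f" and g: "integrable lborel g"
  shows "stft (fourier g) (fourier f) (\<xi>, - x) = (2 * pi) ^ CARD('n) * exp (\<i> * complex_of_real (x \<bullet> \<xi>)) * stft g f (x, \<xi>)"
proof -
  note f' = fourier_invertibleD[OF f]
  have [measurable]: "f \<in> borel_measurable borel" "g \<in> borel_measurable borel"
    using f' g borel_measurable_integrable by force+
  have g': "integrable lborel (\<lambda>t. cnj (g t))"
    using g by simp
  \<comment> \<open>All phases are collected in one unimodular kernel, as required by
    \<open>Fubini_kernel\<close>.\<close>
  let ?k = "\<lambda>\<eta> t. exp (\<i> * complex_of_real (t \<bullet> (\<eta> - \<xi>) + \<eta> \<bullet> x))"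
  have "cnj (fourier g \<eta>) = (\<integral>t. cnj (g t) * exp (\<i> * complex_of_real (t \<bullet> \<eta>)) \<partial>lborel)" for \<eta>
    unfolding fourier_def by (subst Bochner_Integration.integral_cnj[symmetric]) (simp add: exp_cnj mult.commute)
  then have "stft (fourier g) (fourier f) (\<xi>, - x) =
     (\<integral>\<eta>. fourier f \<eta> * (\<integral>t. cnj (g t) * exp (\<i> * complex_of_real (t \<bullet> (\<eta> - \<xi>))) \<partial>lborel) * exp (\<i> * complex_of_real (\<eta> \<bullet> x)) \<partial>lborel)"
    unfolding stft_def by simp
  also have "\<dots> = (\<integral>\<eta>. fourier f \<eta> * (\<integral>t. cnj (g t) * ?k \<eta> t \<partial>lborel) \<partial>lborel)"
    by (intro Bochner_Integration.integral_cong refl)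
       (simp add: mult.assoc distrib_left exp_add flip: integral_mult_left_zero)
  also have "\<dots> = (\<integral>t. cnj (g t) * (\<integral>\<eta>. fourier f \<eta> * ?k \<eta> t \<partial>lborel) \<partial>lborel)"
    by (rule Fubini_kernel[OF f'(2) g']) (simp_all only: cmod_exp_i order_refl, measurable)
  also have "\<dots> = (\<integral>t. cnj (g t) * ((2 * pi) ^ CARD('n) * f (t + x) * exp (- (\<i> * complex_of_real (t \<bullet> \<xi>)))) \<partial>lborel)"
  proof (intro Bochner_Integration.integral_cong refl arg_cong2[where f="(*)"])
    fix t
    have "(\<integral>\<eta>. fourier f \<eta> * ?k \<eta> t \<partial>lborel) =
      (\<integral>\<eta>. fourier f \<eta> * exp (\<i> * complex_of_real ((t + x) \<bullet> \<eta>)) * exp (- (\<i> * complex_of_real (t \<bullet> \<xi>))) \<partial>lborel)"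
      by (intro Bochner_Integration.integral_cong refl)
         (simp add: mult.assoc inner_commute[of x] algebra_simps flip: exp_add)
    then show "(\<integral>\<eta>. fourier f \<eta> * ?k \<eta> t \<partial>lborel) = (2 * pi) ^ CARD('n) * f (t + x) * exp (- (\<i> * complex_of_real (t \<bullet> \<xi>)))"
      by (simp only: integral_mult_left_zero fourier_inversion[OF f'(1-4)])
  qed
  also have "\<dots> = (\<integral>y. cnj (g (y - x)) * ((2 * pi) ^ CARD('n) * f y * exp (- (\<i> * complex_of_real ((y - x) \<bullet> \<xi>)))) \<partial>lborel)"
    by (subst integral_lborel_affine[where c = 1 and t = "- x"]) (simp_all add: inner_diff_left)
  also have "\<dots> = (\<integral>y. (2 * pi) ^ CARD('n) * exp (\<i> * complex_of_real (x \<bullet> \<xi>)) *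
      (f y * cnj (g (y - x)) * exp (- (\<i> * complex_of_real (y \<bullet> \<xi>)))) \<partial>lborel)"
    by (intro Bochner_Integration.integral_cong refl)
       (simp add: inner_diff_left right_diff_distrib exp_diff exp_minus field_simps)
  finally show ?thesis
    by (simp add: stft_def)
qed

lemma cmod_stft_fourier:
  fixes f g :: "real^'n::finite \<Rightarrow> complex"
  assumes "fourier_invertible f" "integrable lborel g"
  shows "cmod (stft (fourier g) (fourier f) (\<xi>, - x)) = (2 * pi) ^ CARD('n) * cmod (stft g f (x, \<xi>))"
  by (simp add: stft_fourier[OF assms] norm_mult norm_power)

lemma cmod_stft_le:
  "ennreal (cmod (stft g f (x, \<xi>))) \<le> (\<integral>\<^sup>+y. cmod (f y) * cmod (g (y - x)) \<partial>lborel)"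
  using norm_integral_le_nn_integral[of lborel "\<lambda>y. f y * cnj (g (y - x)) * exp (- (\<i> * complex_of_real (y \<bullet> \<xi>)))"]
  by (simp add: stft_def norm_mult)

lemma cmod_rihaczek: "cmod (rihaczek f z) = cmod (f (fst z)) * cmod (fourier f (snd z))"
  by (cases z) (simp add: rihaczek_def norm_mult)

text \<open>One factor is bounded by an integral over positions, the other by an integral over
  frequencies. Their product is a single integral over phase space, where the four moduli regroup
  into the two Rihaczek forms.\<close>

lemma spectrogram_le:
  fixes f g :: "real^'n::finite \<Rightarrow> complex"
  assumes f: "fourier_invertible f" and g: "fourier_invertible g"
  shows "ennreal ((2 * pi) ^ CARD('n) * spectrogram g f z)
    \<le> (\<integral>\<^sup>+w. cmod (rihaczek f w) * cmod (rihaczek g (w - z)) \<partial>lborel)"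
proof (cases z)
  case (Pair x \<xi>)
  note [measurable] = fourier_invertibleD(5,6)[OF f] fourier_invertibleD(5,6)[OF g]
  have "ennreal ((2 * pi) ^ CARD('n) * spectrogram g f z)
      = ennreal (cmod (stft g f (x, \<xi>))) * ennreal (cmod (stft (fourier g) (fourier f) (\<xi>, - x)))"
    by (simp add: Pair spectrogram_def cmod_stft_fourier[OF f fourier_invertibleD(1)[OF g]] power2_eq_square mult_ac
             flip: ennreal_mult)
  also have "\<dots> \<le> (\<integral>\<^sup>+y. cmod (f y) * cmod (g (y - x)) \<partial>lborel) *
      (\<integral>\<^sup>+\<eta>. cmod (fourier f \<eta>) * cmod (fourier g (\<eta> - \<xi>)) \<partial>lborel)"
    by (intro mult_mono cmod_stft_le) auto
  also have "\<dots> = (\<integral>\<^sup>+w. ennreal (cmod (f (fst w)) * cmod (g (fst w - x)))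
      * ennreal (cmod (fourier f (snd w)) * cmod (fourier g (snd w - \<xi>))) \<partial>lborel)"
    by (rule nn_integral_lborel_times[symmetric]) measurable
  also have "\<dots> = (\<integral>\<^sup>+w. cmod (rihaczek f w) * cmod (rihaczek g (w - z)) \<partial>lborel)"
    by (simp add: cmod_rihaczek Pair mult_ac flip: ennreal_mult)
  finally show ?thesis .
qed

section \<open>Recovering a function and its transform from the short-time Fourier transform\<close>

text \<open>Up to a constant, the slice has the modulus of the short-time transform of
  \<open>fourier f\<close> and \<open>fourier g\<close> in its first variable. That is dominated by
  a convolution of two integrable functions, which Tonelli's theorem shows to be integrable.\<close>

lemma integrable_stft_slice:
  fixes f g :: "real^'n::finite \<Rightarrow> complex"
  assumes f: "fourier_invertible f" and g: "fourier_invertible g"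
  shows "integrable lborel (\<lambda>\<eta>. stft g f (y, \<eta>))"
proof -
  note [measurable] = fourier_invertibleD(5,6)[OF f] fourier_invertibleD(5,6)[OF g]
  let ?V = "\<lambda>\<eta>. cmod (stft g f (y, \<eta>))"
  have [measurable]: "(\<lambda>\<eta>. stft g f (y, \<eta>)) \<in> borel_measurable borel"
    by measurable
  have "ennreal ((2 * pi) ^ CARD('n)) * (\<integral>\<^sup>+\<eta>. ?V \<eta> \<partial>lborel)
      = (\<integral>\<^sup>+\<eta>. cmod (stft (fourier g) (fourier f) (\<eta>, - y)) \<partial>lborel)"
    by (simp add: cmod_stft_fourier[OF f fourier_invertibleD(1)[OF g]] ennreal_mult nn_integral_cmult)
  also have "\<dots> \<le> (\<integral>\<^sup>+\<eta>. \<integral>\<^sup>+\<zeta>. cmod (fourier f \<zeta>) * cmod (fourier g (\<zeta> - \<eta>)) \<partial>lborel \<partial>lborel)"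
    by (intro nn_integral_mono cmod_stft_le)
  also have "\<dots> = (\<integral>\<^sup>+\<zeta>. \<integral>\<^sup>+\<eta>. cmod (fourier f \<zeta>) * cmod (fourier g (\<zeta> - \<eta>)) \<partial>lborel \<partial>lborel)"
    by (rule lborel_pair.Fubini'[symmetric]) measurable
  also have "\<dots> = (\<integral>\<^sup>+\<zeta>. ennreal (cmod (fourier f \<zeta>)) * (\<integral>\<^sup>+\<eta>. cmod (fourier g \<eta>) \<partial>lborel) \<partial>lborel)"
  proof (intro nn_integral_cong)
    fix \<zeta>
    show "(\<integral>\<^sup>+\<eta>. cmod (fourier f \<zeta>) * cmod (fourier g (\<zeta> - \<eta>)) \<partial>lborel)
        = ennreal (cmod (fourier f \<zeta>)) * (\<integral>\<^sup>+\<eta>. cmod (fourier g \<eta>) \<partial>lborel)"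
      by (subst (2) nn_integral_lborel_affine[where c = "-1" and t = \<zeta>])
         (simp_all add: ennreal_mult nn_integral_cmult)
  qed
  also have "\<dots> = (\<integral>\<^sup>+\<zeta>. cmod (fourier f \<zeta>) \<partial>lborel) * (\<integral>\<^sup>+\<eta>. cmod (fourier g \<eta>) \<partial>lborel)"
    by (simp add: nn_integral_multc)
  also have "\<dots> < \<infinity>"
    using fourier_invertibleD(2)[OF f] fourier_invertibleD(2)[OF g] by (simp add: integrable_iff_bounded ennreal_mult_less_top)
  finally have "(\<integral>\<^sup>+\<eta>. ?V \<eta> \<partial>lborel) < \<infinity>"
    by (auto simp: ennreal_mult_less_top)
  then show ?thesis
    by (simp add: integrable_iff_bounded)
qed

lemma stft_slice_ge:
  fixes f g :: "real^'n::finite \<Rightarrow> complex"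
  assumes f: "fourier_invertible f" and g: "fourier_invertible g"
  shows "ennreal ((2 * pi) ^ CARD('n) * cmod (f x) * cmod (g (x - y))) \<le> (\<integral>\<^sup>+\<eta>. cmod (stft g f (y, \<eta>)) \<partial>lborel)"
proof -
  \<comment> \<open>The slice at \<open>y\<close> is the Fourier transform of \<open>h\<close>.
    Evaluating the inversion formula for \<open>h\<close> at \<open>x\<close> and dropping the phase
    gives the claim.\<close>
  define h where "h = (\<lambda>x. f x * cnj (g (x - y)))"
  have [measurable]: "g \<in> borel_measurable borel" by (rule fourier_invertibleD[OF g])
  obtain B where B: "\<And>x. cmod (f x) \<le> B"
    using fourier_invertibleD(4)[OF f] by (auto simp: bounded_iff)
  obtain C where C: "\<And>x. cmod (g x) \<le> C"
    using fourier_invertibleD(4)[OF g] by (auto simp: bounded_iff)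
  have fh: "fourier h \<eta> = stft g f (y, \<eta>)" for \<eta>
    by (simp add: stft_eq_fourier h_def)
  have "integrable lborel h"
  proof (rule Bochner_Integration.integrable_bound)
    show "integrable lborel (\<lambda>x. C * cmod (f x))"
      using fourier_invertibleD(1)[OF f] by simp
    show "h \<in> borel_measurable lborel"
      using fourier_invertibleD(5)[OF f] fourier_invertibleD(5)[OF g] unfolding h_def by measurable
    have "cmod (f x) * cmod (g (x - y)) \<le> \<bar>C * cmod (f x)\<bar>" for x
      using mult_left_mono[OF C[of "x - y"], of "cmod (f x)"] by (simp add: mult.commute)
    then show "AE x in lborel. norm (h x) \<le> norm (C * cmod (f x))"
      by (simp add: h_def norm_mult)
  qed
  moreover have "continuous_on UNIV h"
  proof -
    have "continuous_on UNIV (\<lambda>x. g (x - y))"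
      by (rule continuous_on_compose2[OF fourier_invertibleD(3)[OF g]]) (auto intro: continuous_intros)
    then show ?thesis
      unfolding h_def by (intro continuous_on_mult continuous_on_cnj fourier_invertibleD(3)[OF f])
  qed
  moreover have "bounded (range h)"
    unfolding bounded_iff
  proof (intro exI[of _ "B * C"] ballI)
    fix z assume "z \<in> range h"
    then obtain x where "z = h x" by blast
    moreover have "cmod (f x) * cmod (g (x - y)) \<le> B * C"
      using order_trans[OF norm_ge_zero B] by (intro mult_mono B C) auto
    ultimately show "cmod z \<le> B * C"
      by (simp add: h_def norm_mult)
  qed
  moreover have "integrable lborel (fourier h)"
    using integrable_stft_slice[OF f g] by (simp add: fh[abs_def])
  ultimately have "(\<integral>\<eta>. fourier h \<eta> * exp (\<i> * complex_of_real (x \<bullet> \<eta>)) \<partial>lborel) = (2 * pi) ^ CARD('n) * h x"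
    by (intro fourier_inversion)
  moreover have "ennreal (cmod (\<integral>\<eta>. fourier h \<eta> * exp (\<i> * complex_of_real (x \<bullet> \<eta>)) \<partial>lborel))
      \<le> (\<integral>\<^sup>+\<eta>. cmod (fourier h \<eta>) \<partial>lborel)"
    using norm_integral_le_nn_integral[of lborel "\<lambda>\<eta>. fourier h \<eta> * exp (\<i> * complex_of_real (x \<bullet> \<eta>))"]
    by (simp add: norm_mult)
  ultimately show ?thesis
    by (simp add: fh norm_mult norm_power) (simp add: h_def norm_mult mult.assoc)
qed

text \<open>Multiply \<open>stft_slice_ge\<close> by a second factor \<open>cmod (g (x - y))\<close>
  and integrate over \<open>y\<close>. This makes the left side an L^2 norm and leaves on the right
  a decaying factor that can later absorb part of the weight at \<open>x\<close>.\<close>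

lemma cmod_le_stft:
  fixes f g :: "real^'n::finite \<Rightarrow> complex"
  assumes f: "fourier_invertible f" and g: "fourier_invertible g"
  shows "ennreal ((2 * pi) ^ CARD('n) * cmod (f x)) * (\<integral>\<^sup>+y. (cmod (g y))\<^sup>2 \<partial>lborel)
    \<le> (\<integral>\<^sup>+w. cmod (stft g f w) * cmod (g (x - fst w)) \<partial>lborel)"
proof -
  note [measurable] = fourier_invertibleD(5)[OF f] fourier_invertibleD(5)[OF g]
  have "ennreal ((2 * pi) ^ CARD('n) * cmod (f x)) * (\<integral>\<^sup>+y. (cmod (g y))\<^sup>2 \<partial>lborel)
     = ennreal ((2 * pi) ^ CARD('n) * cmod (f x)) * (\<integral>\<^sup>+y. (cmod (g (x - y)))\<^sup>2 \<partial>lborel)"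
    by (subst nn_integral_lborel_affine[where c = "-1" and t = x]) simp_all
  also have "\<dots> = (\<integral>\<^sup>+y. ennreal ((2 * pi) ^ CARD('n) * cmod (f x) * cmod (g (x - y))) * ennreal (cmod (g (x - y))) \<partial>lborel)"
    by (simp add: power2_eq_square mult.assoc flip: nn_integral_cmult ennreal_mult)
  also have "\<dots> \<le> (\<integral>\<^sup>+y. (\<integral>\<^sup>+\<eta>. cmod (stft g f (y, \<eta>)) \<partial>lborel) * ennreal (cmod (g (x - y))) \<partial>lborel)"
    by (intro nn_integral_mono mult_right_mono stft_slice_ge[OF f g]) simp
  also have "\<dots> = (\<integral>\<^sup>+y. (\<integral>\<^sup>+\<eta>. cmod (stft g f (y, \<eta>)) * cmod (g (x - y)) \<partial>lborel) \<partial>lborel)"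
    by (intro nn_integral_cong, subst nn_integral_multc[symmetric]) (simp_all add: ennreal_mult)
  also have "\<dots> = (\<integral>\<^sup>+w. cmod (stft g f w) * cmod (g (x - fst w)) \<partial>lborel)"
    by (subst lborel_prod[symmetric], subst lborel.nn_integral_fst[symmetric]) simp_all
  finally show ?thesis .
qed

lemma integrable_square:
  assumes "fourier_invertible g"
  shows "integrable lborel (\<lambda>y. (cmod (g y))\<^sup>2)"
proof -
  obtain C where C: "\<And>x. cmod (g x) \<le> C"
    using fourier_invertibleD(4)[OF assms] by (auto simp: bounded_iff)
  show ?thesis
  proof (rule Bochner_Integration.integrable_bound)
    show "integrable lborel (\<lambda>x. C * cmod (g x))"
      using fourier_invertibleD(1)[OF assms] by simp
    have "(cmod (g x))\<^sup>2 \<le> \<bar>C * cmod (g x)\<bar>" for x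
      using mult_right_mono[OF C[of x], of "cmod (g x)"] by (simp add: power2_eq_square)
    then show "AE x in lborel. norm ((cmod (g x))\<^sup>2) \<le> norm (C * cmod (g x))"
      by simp
    show "(\<lambda>y. (cmod (g y))\<^sup>2) \<in> borel_measurable lborel"
      using fourier_invertibleD(5)[OF assms] by measurable
  qed
qed

text \<open>At the origin the short-time transform of a function with itself as window is its
  squared L^2 norm, so this is \<open>cmod_stft_fourier\<close> at \<open>x = 0\<close>,
  \<open>\<xi> = 0\<close>.\<close>

lemma fourier_plancherel:
  fixes g :: "real^'n::finite \<Rightarrow> complex"
  assumes g: "fourier_invertible g"
  shows "(\<integral>\<^sup>+y. (cmod (fourier g y))\<^sup>2 \<partial>lborel) = ennreal ((2 * pi) ^ CARD('n)) * (\<integral>\<^sup>+y. (cmod (g y))\<^sup>2 \<partial>lborel)"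
proof -
  have "cmod (stft h h (0, 0)) = (\<integral>y. (cmod (h y))\<^sup>2 \<partial>lborel)" for h :: "real^'n \<Rightarrow> complex"
  proof -
    have "stft h h (0, 0) = complex_of_real (\<integral>y. (cmod (h y))\<^sup>2 \<partial>lborel)"
      by (simp add: stft_def complex_norm_square del: of_real_power flip: integral_complex_of_real)
    then show ?thesis
      by (simp only: norm_of_real) simp
  qed
  then have "(\<integral>y. (cmod (fourier g y))\<^sup>2 \<partial>lborel) = (2 * pi) ^ CARD('n) * (\<integral>y. (cmod (g y))\<^sup>2 \<partial>lborel)"
    using cmod_stft_fourier[OF g fourier_invertibleD(1)[OF g], of 0 0] by simp
  then show ?thesis
    by (simp add: nn_integral_eq_integral integrable_square g fourier_invertible_fourier ennreal_mult)
qed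

text \<open>Apply \<open>cmod_le_stft\<close> to the two transforms. Plancherel gives an extra
  factor \<open>(2 * pi) ^ CARD('n)\<close> on the left, and returning to \<open>stft g f\<close>
  gives the same factor on the right after a reflection and an exchange of the integrals; it is
  positive and finite and cancels.\<close>

lemma cmod_fourier_le_stft:
  fixes f g :: "real^'n::finite \<Rightarrow> complex"
  assumes f: "fourier_invertible f" and g: "fourier_invertible g"
  shows "ennreal ((2 * pi) ^ CARD('n) * cmod (fourier f \<xi>)) * (\<integral>\<^sup>+y. (cmod (g y))\<^sup>2 \<partial>lborel)
    \<le> (\<integral>\<^sup>+w. cmod (stft g f w) * cmod (fourier g (\<xi> - snd w)) \<partial>lborel)" (is "?L \<le> ?R")
proof -
  note [measurable] = fourier_invertibleD(5,6)[OF f] fourier_invertibleD(5,6)[OF g]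
  let ?c = "ennreal ((2 * pi) ^ CARD('n))"
  let ?W = "\<lambda>w. ennreal (cmod (stft (fourier g) (fourier f) w))"
  have "?c * ?L \<le> (\<integral>\<^sup>+w. cmod (stft (fourier g) (fourier f) w) * cmod (fourier g (\<xi> - fst w)) \<partial>lborel)"
    using cmod_le_stft[OF fourier_invertible_fourier[OF f] fourier_invertible_fourier[OF g], of \<xi>]
    by (simp add: fourier_plancherel[OF g] mult_ac)
  also have "\<dots> = (\<integral>\<^sup>+\<eta>. \<integral>\<^sup>+y. ?W (\<eta>, y) * ennreal (cmod (fourier g (\<xi> - \<eta>))) \<partial>lborel \<partial>lborel)"
    by (subst lborel_prod[symmetric], subst lborel.nn_integral_fst[symmetric]) (simp_all add: ennreal_mult)
  also have "\<dots> = (\<integral>\<^sup>+\<eta>. \<integral>\<^sup>+y. ?W (\<eta>, - y) * ennreal (cmod (fourier g (\<xi> - \<eta>))) \<partial>lborel \<partial>lborel)"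
    by (rule nn_integral_cong, subst nn_integral_lborel_affine[where c = "-1" and t = 0]) simp_all
  also have "\<dots> = (\<integral>\<^sup>+\<eta>. \<integral>\<^sup>+y. ?c * (cmod (stft g f (y, \<eta>)) * cmod (fourier g (\<xi> - \<eta>))) \<partial>lborel \<partial>lborel)"
    by (simp add: cmod_stft_fourier[OF f fourier_invertibleD(1)[OF g]] ennreal_mult mult_ac)
  also have "\<dots> = ?c * (\<integral>\<^sup>+\<eta>. \<integral>\<^sup>+y. cmod (stft g f (y, \<eta>)) * cmod (fourier g (\<xi> - \<eta>)) \<partial>lborel \<partial>lborel)"
    by (simp add: nn_integral_cmult)
  also have "(\<integral>\<^sup>+\<eta>. \<integral>\<^sup>+y. cmod (stft g f (y, \<eta>)) * cmod (fourier g (\<xi> - \<eta>)) \<partial>lborel \<partial>lborel)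
      = (\<integral>\<^sup>+y. \<integral>\<^sup>+\<eta>. cmod (stft g f (y, \<eta>)) * cmod (fourier g (\<xi> - \<eta>)) \<partial>lborel \<partial>lborel)"
    by (rule lborel_pair.Fubini'[symmetric]) measurable
  also have "\<dots> = ?R"
    by (subst lborel_prod[symmetric], subst lborel.nn_integral_fst[symmetric]) simp_all
  finally show ?thesis
    by (subst (asm) ennreal_mult_le_mult_iff) (simp_all)
qed

section \<open>Weighted norms\<close>

text \<open>The set where the bound fails is open, and a nonempty open set is not
  negligible.\<close>

lemma AE_continuous_le:
  fixes h :: "'a::euclidean_space \<Rightarrow> real"
  assumes h: "continuous_on UNIV h" and ae: "AE x in lborel. h x \<le> c"
  shows "h x \<le> c"
proof (rule ccontr)
  assume "\<not> h x \<le> c"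
  then have "x \<in> {x. c < h x}" by simp
  then have ne: "{x. c < h x} \<noteq> {}" by blast
  have op: "open {x. c < h x}"
    by (intro open_Collect_less continuous_intros h)
  have "{x. c < h x} \<in> null_sets lborel"
    using ae by (subst AE_iff_null_sets) (use op in \<open>auto simp: not_less\<close>)
  then have "negligible {x. c < h x}"
    by (simp add: negligible_iff_null_sets null_sets_completionI)
  with open_not_negligible[OF op ne] show False by simp
qed

lemma Lp_norm_infinity_AE: "AE x in lborel. ennreal (norm (f x)) \<le> Lp_norm \<infinity> f"
  by (simp add: Lp_norm_def esssup_AE)

lemma Lp_norm_infinity_le:
  assumes "f \<in> borel_measurable borel" "AE x in lborel. ennreal (norm (f x)) \<le> c"
  shows "Lp_norm \<infinity> f \<le> c"
  unfolding Lp_norm_def using assms by (auto intro!: esssup_I)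

lemma le_Lp_norm_infinity:
  assumes h: "continuous_on UNIV h"
  shows "ennreal (norm (h x)) \<le> Lp_norm \<infinity> h"
proof (cases "Lp_norm \<infinity> h")
  case (real c)
  have "norm (h x) \<le> c"
  proof (rule AE_continuous_le[where h = "\<lambda>x. norm (h x)"])
    show "continuous_on UNIV (\<lambda>x. norm (h x))"
      by (intro continuous_intros h)
    show "AE x in lborel. norm (h x) \<le> c"
      using Lp_norm_infinity_AE[of h] real by (auto elim!: eventually_mono simp: ennreal_le_iff)
  qed
  then have "ennreal (norm (h x)) \<le> ennreal c"
    by (rule ennreal_leI)
  then show ?thesis
    using real by simp
qed simp

section \<open>Hoelder's inequality and other properties of the extended-valued norms\<close>

lemma enn_powr_pos: "0 < u \<Longrightarrow> 0 < enn_powr u r"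
  by (cases u) (auto simp: enn_powr_def)

lemma enn_powr_top: "enn_powr top r = top"
  by (simp add: enn_powr_def)

lemma enn_powr_ennreal: "0 \<le> a \<Longrightarrow> enn_powr (ennreal a) r = ennreal (a powr r)"
  by (simp add: enn_powr_def)

lemma enn_powr_1 [simp]: "enn_powr u 1 = u"
  by (cases u) (auto simp: enn_powr_def)

lemma Lp_norm_1: "Lp_norm 1 f = (\<integral>\<^sup>+x. norm (f x) \<partial>lborel)"
  by (simp add: Lp_norm_def)

lemma conj_exponent_ennreal:
  assumes "1 < r"
  shows "conj_exponent (ennreal r) = ennreal (r / (r - 1))"
proof -
  have "1 - inverse (ennreal r) = ennreal (1 - 1 / r)"
    using assms by (simp add: inverse_ennreal inverse_eq_divide ennreal_minus flip: ennreal_1)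
  then show ?thesis
    using assms by (simp add: conj_exponent_def inverse_ennreal field_simps)
qed

text \<open>Young's inequality for the normalised functions, after the degenerate values of the two
  integrals have been treated separately.\<close>

lemma Holder_finite:
  fixes u v :: "'a \<Rightarrow> real"
  assumes [measurable]: "u \<in> borel_measurable M" "v \<in> borel_measurable M"
    and nn: "\<And>x. 0 \<le> u x" "\<And>x. 0 \<le> v x"
    and pq: "1 < p" "1 < q" "1 / p + 1 / q = 1"
  shows "(\<integral>\<^sup>+x. u x * v x \<partial>M) \<le> enn_powr (\<integral>\<^sup>+x. u x powr p \<partial>M) (1 / p) * enn_powr (\<integral>\<^sup>+x. v x powr q \<partial>M) (1 / q)"
proof -
  define A where "A = (\<integral>\<^sup>+x. u x powr p \<partial>M)"
  define B where "B = (\<integral>\<^sup>+x. v x powr q \<partial>M)"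
  \<comment> \<open>Zero is split off first: in \<open>ennreal\<close> the product of 0 and
    \<infinity> is 0, so an infinite integral makes the right side infinite only if the other
    integral is nonzero.\<close>
  consider "A = 0 \<or> B = 0" | "A \<noteq> 0" "B \<noteq> 0" "A = \<infinity> \<or> B = \<infinity>"
    | a b where "A = ennreal a" "B = ennreal b" "0 < a" "0 < b"
    by (cases A; cases B) (auto simp: less_le)
  then show ?thesis
  proof cases
    case 1
    then have "AE x in M. u x * v x = 0"
    proof
      assume "A = 0"
      then have "AE x in M. ennreal (u x powr p) = 0"
        unfolding A_def by (subst (asm) nn_integral_0_iff_AE) auto
      then show ?thesis by (auto elim!: eventually_mono)
    next
      assume "B = 0"
      then have "AE x in M. ennreal (v x powr q) = 0"
        unfolding B_def by (subst (asm) nn_integral_0_iff_AE) auto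
      then show ?thesis by (auto elim!: eventually_mono)
    qed
    then have "(\<integral>\<^sup>+x. u x * v x \<partial>M) = (\<integral>\<^sup>+x. 0 \<partial>M)"
      by (intro nn_integral_cong_AE) (auto elim!: eventually_mono)
    then show ?thesis by simp
  next
    case 2
    then have "0 < A" "0 < B"
      by (simp_all add: zero_less_iff_neq_zero)
    then have pos: "enn_powr A (1 / p) > 0" "enn_powr B (1 / q) > 0"
      by (simp_all only: enn_powr_pos)
    then have "enn_powr A (1 / p) * enn_powr B (1 / q) = \<infinity>"
      using 2(3) pos by (auto simp: enn_powr_top ennreal_top_mult ennreal_mult_top)
    then show ?thesis by (simp add: A_def B_def)
  next
    case 3
    \<comment> \<open>These are the norms of \<open>u\<close> and \<open>v\<close>. Young's
      inequality for \<open>u x / \<alpha>\<close> and \<open>v x / \<beta>\<close> integrates to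
      \<open>1 / p + 1 / q\<close>, which is 1.\<close>
    define \<alpha> \<beta> where "\<alpha> = a powr (1 / p)" and "\<beta> = b powr (1 / q)"
    have pos: "0 < \<alpha>" "0 < \<beta>" and pw: "\<alpha> powr p = a" "\<beta> powr q = b"
      using 3 pq by (simp_all add: \<alpha>_def \<beta>_def powr_powr)
    have young: "u x * v x \<le> \<alpha> * \<beta> / (p * a) * u x powr p + \<alpha> * \<beta> / (q * b) * v x powr q" for x
    proof -
      have "u x / \<alpha> * (v x / \<beta>) \<le> (u x / \<alpha>) powr p / p + (v x / \<beta>) powr q / q"
        using pos nn by (intro Youngs_inequality pq) auto
      also have "\<dots> = u x powr p / (p * a) + v x powr q / (q * b)"
        using pos nn by (simp add: powr_divide pw mult.commute)
      finally have "\<alpha> * \<beta> * (u x / \<alpha> * (v x / \<beta>)) \<le> \<alpha> * \<beta> * (u x powr p / (p * a) + v x powr q / (q * b))"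
        using pos by (intro mult_left_mono) auto
      then show ?thesis
        using pos by (simp add: distrib_left)
    qed
    have "(\<integral>\<^sup>+x. u x * v x \<partial>M) \<le> (\<integral>\<^sup>+x. ennreal (\<alpha> * \<beta> / (p * a)) * ennreal (u x powr p)
        + ennreal (\<alpha> * \<beta> / (q * b)) * ennreal (v x powr q) \<partial>M)"
      using young pos pq 3 nn by (intro nn_integral_mono) (simp flip: ennreal_mult ennreal_plus)
    also have "\<dots> = ennreal (\<alpha> * \<beta> / (p * a)) * A + ennreal (\<alpha> * \<beta> / (q * b)) * B"
      by (simp add: nn_integral_add nn_integral_cmult A_def B_def)
    also have "\<dots> = ennreal (\<alpha> * \<beta> * (1 / p + 1 / q))"
      using 3 pos pq(1,2) by (simp add: distrib_left flip: ennreal_mult ennreal_plus)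
    also have "\<dots> = ennreal (a powr (1 / p)) * ennreal (b powr (1 / q))"
      using pq by (simp add: \<alpha>_def \<beta>_def ennreal_mult)
    also have "\<dots> = enn_powr A (1 / p) * enn_powr B (1 / q)"
      using 3 by (simp add: enn_powr_ennreal)
    finally show ?thesis by (simp add: A_def B_def)
  qed
qed

lemma Holder_infinity:
  fixes u :: "'a::euclidean_space \<Rightarrow> 'b::real_normed_vector" and v :: "'a \<Rightarrow> 'c::real_normed_vector"
  assumes [measurable]: "u \<in> borel_measurable borel" "v \<in> borel_measurable borel"
  shows "(\<integral>\<^sup>+x. norm (u x) * norm (v x) \<partial>lborel) \<le> Lp_norm \<infinity> u * Lp_norm 1 v"
proof -
  have "(\<integral>\<^sup>+x. norm (u x) * norm (v x) \<partial>lborel) \<le> (\<integral>\<^sup>+x. Lp_norm \<infinity> u * ennreal (norm (v x)) \<partial>lborel)"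
    using Lp_norm_infinity_AE[of u]
    by (intro nn_integral_mono_AE) (auto elim!: eventually_mono intro: mult_right_mono simp: ennreal_mult)
  also have "\<dots> = Lp_norm \<infinity> u * Lp_norm 1 v"
    by (simp add: nn_integral_cmult Lp_norm_1)
  finally show ?thesis .
qed

lemma Lp_norm_Holder:
  fixes u :: "'a::euclidean_space \<Rightarrow> 'b::real_normed_vector" and v :: "'a \<Rightarrow> 'c::real_normed_vector"
  assumes uv: "u \<in> borel_measurable borel" "v \<in> borel_measurable borel" and p: "1 \<le> p"
  shows "(\<integral>\<^sup>+x. norm (u x) * norm (v x) \<partial>lborel) \<le> Lp_norm p u * Lp_norm (conj_exponent p) v"
proof -
  consider "p = \<infinity>" | "p = 1" | r where "p = ennreal r" "1 < r"
    using p by (cases p) (auto simp: less_le simp flip: ennreal_1)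
  then show ?thesis
  proof cases
    case 1
    then show ?thesis using Holder_infinity[OF uv] by (simp add: conj_exponent_top[simplified])
  next
    case 2
    then show ?thesis using Holder_infinity[OF uv(2,1)] by (simp add: conj_exponent_1[simplified] mult.commute)
  next
    case 3
    note [measurable] = uv
    have "(\<integral>\<^sup>+x. norm (u x) * norm (v x) \<partial>lborel) \<le> enn_powr (\<integral>\<^sup>+x. norm (u x) powr r \<partial>lborel) (1 / r)
        * enn_powr (\<integral>\<^sup>+x. norm (v x) powr (r / (r - 1)) \<partial>lborel) (1 / (r / (r - 1)))"
      using 3 by (intro Holder_finite) (auto simp: field_simps)
    then show ?thesis
      using 3 by (simp add: Lp_norm_def conj_exponent_ennreal)
  qed
qed

text \<open>Translation invariance of \<open>lborel\<close>: it preserves the almost-everywhere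
  bound when \<open>q = \<infinity>\<close>, and is a substitution in the integral
  otherwise.\<close>

lemma Lp_norm_translate_le:
  fixes v :: "'a::euclidean_space \<Rightarrow> 'b::real_normed_vector"
  assumes [measurable]: "v \<in> borel_measurable borel"
  shows "Lp_norm q (\<lambda>x. v (x - z)) \<le> Lp_norm q v"
proof (cases "q = \<infinity>")
  case True
  have "AE x in distr lborel borel ((+) (- z)). ennreal (norm (v x)) \<le> Lp_norm \<infinity> v"
    unfolding lborel_distr_plus by (rule Lp_norm_infinity_AE)
  then have "AE x in lborel. ennreal (norm (v (- z + x))) \<le> Lp_norm \<infinity> v"
    by (subst (asm) AE_distr_iff) auto
  then show ?thesis
    unfolding True by (intro Lp_norm_infinity_le) (auto elim!: eventually_mono)
next
  case False
  have "(\<integral>\<^sup>+x. ennreal (norm (v x) powr enn2real q) \<partial>lborel)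
      = (\<integral>\<^sup>+x. ennreal (norm (v (x - z)) powr enn2real q) \<partial>lborel)"
    by (subst nn_integral_lborel_affine[where c = 1 and t = "- z"]) simp_all
  then show ?thesis
    using False by (simp add: Lp_norm_def)
qed

text \<open>Passes from the modulus of the short-time transform in L^{2p} to the spectrogram in L^p;
  this is the source of the exponent \<open>conj_exponent (2 * p)\<close> in the second
  estimate.\<close>

lemma Lp_norm_square_le:
  fixes h :: "'a::euclidean_space \<Rightarrow> real"
  assumes [measurable]: "h \<in> borel_measurable borel" and p: "1 \<le> p"
  shows "(Lp_norm (2 * p) h)\<^sup>2 \<le> Lp_norm p (\<lambda>x. (h x)\<^sup>2)"
proof (cases "p = \<infinity>")
  case True
  show ?thesis
  proof (cases "Lp_norm \<infinity> (\<lambda>x. (h x)\<^sup>2)")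
    case (real s)
    have "AE x in lborel. ennreal (norm (h x)) \<le> ennreal (sqrt s)"
      using Lp_norm_infinity_AE[of "\<lambda>x. (h x)\<^sup>2"]
    proof (rule eventually_mono)
      fix x assume "ennreal (norm ((h x)\<^sup>2)) \<le> Lp_norm \<infinity> (\<lambda>x. (h x)\<^sup>2)"
      then have "(norm (h x))\<^sup>2 \<le> s"
        using real by simp
      then show "ennreal (norm (h x)) \<le> ennreal (sqrt s)"
        by (intro ennreal_leI real_le_rsqrt)
    qed
    then have "Lp_norm \<infinity> h \<le> ennreal (sqrt s)"
      by (intro Lp_norm_infinity_le) auto
    then have "(Lp_norm \<infinity> h)\<^sup>2 \<le> (ennreal (sqrt s))\<^sup>2"
      by (rule power_mono) simp
    then show ?thesis
      using real True by (simp add: ennreal_power ennreal_mult_top)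
  qed (simp add: True)
next
  case False
  with p obtain r where r: "p = ennreal r" "1 \<le> r"
    by (cases p) (auto simp flip: ennreal_1)
  have 2: "2 * p = ennreal (2 * r)"
    using r by (simp add: ennreal_mult)
  define I where "I = (\<integral>\<^sup>+x. \<bar>h x\<bar> powr (2 * r) \<partial>lborel)"
  have "norm ((h x)\<^sup>2) powr r = \<bar>h x\<bar> powr (2 * r)" for x
    using powr_powr[of "\<bar>h x\<bar>" 2 r] by (cases "h x = 0") simp_all
  then have "Lp_norm p (\<lambda>x. (h x)\<^sup>2) = enn_powr I (1 / r)"
    using r by (simp add: Lp_norm_def I_def)
  moreover have "Lp_norm (2 * p) h = enn_powr I (1 / (2 * r))"
    unfolding 2 using r by (simp add: Lp_norm_def I_def)
  moreover have "(enn_powr I (1 / (2 * r)))\<^sup>2 = enn_powr I (1 / r)"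
  proof (cases I)
    case (real i)
    have "(i powr (1 / (2 * r)))\<^sup>2 = i powr (1 / r)"
      by (simp add: power2_eq_square flip: powr_add)
    then show ?thesis
      using real by (simp add: enn_powr_ennreal ennreal_power)
  qed (simp add: enn_powr_def power2_eq_square ennreal_mult_top)
  ultimately show ?thesis by simp
qed

lemma Lp_norm_2_power4:
  assumes "(\<integral>\<^sup>+x. (cmod (g x))\<^sup>2 \<partial>lborel) = ennreal s" "0 \<le> s"
  shows "Lp_norm 2 g ^ 4 = (ennreal s)\<^sup>2"
proof -
  have "Lp_norm 2 g = ennreal (sqrt s)"
    using assms by (simp add: Lp_norm_def enn_powr_ennreal powr_half_sqrt)
  moreover have "sqrt s ^ 4 = s\<^sup>2"
    using assms power_mult[of "sqrt s" 2 2] by simp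
  ultimately show ?thesis
    using assms by (simp add: ennreal_power)
qed

section \<open>Weight functions and the decay of functions in \<open>S_omega\<close>\<close>

text \<open>Since \<open>s + t\<close> is at most twice the maximum, monotonicity and the doubling
  condition bound the left side in terms of \<omega> at the maximum; nonnegativity allows both
  values to be added.\<close>

lemma weight_add:
  assumes w: "weight_function \<omega> K b" and "0 \<le> s" "0 \<le> t" "0 \<le> r" "r \<le> s + t"
  shows "\<omega> r \<le> K * (1 + \<omega> s + \<omega> t)"
proof -
  define m where "m = max s t"
  have mono: "mono_on {0..} \<omega>" and nn: "\<And>t. 0 \<le> t \<Longrightarrow> 0 \<le> \<omega> t" and K: "1 \<le> K"
    using w by (auto simp: weight_function_def)
  have "\<omega> r \<le> \<omega> (2 * m)"
    using assms by (intro mono_onD[OF mono]) (auto simp: m_def)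
  also have "\<dots> \<le> K * (1 + \<omega> m)"
    using w assms(2) by (auto simp: weight_function_def m_def)
  also have "\<dots> \<le> K * (1 + \<omega> s + \<omega> t)"
    using K nn[of s] nn[of t] assms by (intro mult_left_mono) (auto simp: m_def max_def)
  finally show ?thesis .
qed

lemma weight_nonneg: "weight_function \<omega> K b \<Longrightarrow> 0 \<le> \<omega> (norm x)"
  by (simp add: weight_function_def)

lemma continuous_on_weight:
  fixes \<omega> :: "real \<Rightarrow> real"
  assumes "weight_function \<omega> K b"
  shows "continuous_on UNIV (\<lambda>x::'a::real_normed_vector. \<omega> (norm x))"
proof (rule continuous_on_compose2[where g = \<omega> and t = "{0..}" and f = norm])
  show "continuous_on {0..} \<omega>" using assms by (simp add: weight_function_def)
qed (auto intro: continuous_intros)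

text \<open>The logarithmic lower bound on \<omega> turns the exponential into a power of
  \<open>1 + norm x\<close>, which is dominated by a product of integrable functions of single
  coordinates.\<close>

lemma integrable_exp_weight:
  fixes \<omega> :: "real \<Rightarrow> real"
  assumes w: "weight_function \<omega> K b"
  obtains lam where "0 < lam" "integrable lborel (\<lambda>x::real^'n. exp (- (lam * \<omega> (norm x))))"
proof
  obtain a where a: "\<And>t. 0 \<le> t \<Longrightarrow> a + b * ln (1 + t) \<le> \<omega> t" and b: "0 < b"
    using w by (auto simp: weight_function_def)
  \<comment> \<open>Chosen so that \<open>lam * b = 2 * CARD('n)\<close>, that is, two powers of
    \<open>1 + norm x\<close> for every coordinate.\<close>
  define lam where "lam = 2 * CARD('n) / b"
  show lam: "0 < lam"
    using b by (simp add: lam_def)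
  have "integrable lborel (\<lambda>x::real. inverse (1 + x\<^sup>2))"
    using integrable_inverse_1_plus_square by (simp add: set_integrable_def)
  then have "integrable lborel (\<lambda>x::real^'n. \<Prod>i\<in>Basis. inverse (1 + (x \<bullet> i)\<^sup>2))"
    by (intro integral_lborel_prod)
  then have int: "integrable lborel (\<lambda>x::real^'n. exp (- (lam * a)) * (\<Prod>i\<in>Basis. inverse (1 + (x \<bullet> i)\<^sup>2)))"
    by simp
  have le: "exp (- (lam * \<omega> (norm x))) \<le> exp (- (lam * a)) * (\<Prod>i\<in>Basis. inverse (1 + (x \<bullet> i)\<^sup>2))" for x :: "real^'n"
  proof -
    have "lam * a + 2 * CARD('n) * ln (1 + norm x) = lam * (a + b * ln (1 + norm x))"
      using b by (simp add: lam_def field_simps)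
    also have "\<dots> \<le> lam * \<omega> (norm x)"
      using lam by (intro mult_left_mono a) auto
    finally have "exp (- (lam * \<omega> (norm x))) \<le> exp (- (lam * a) - 2 * CARD('n) * ln (1 + norm x))"
      by simp
    also have "\<dots> = exp (- (lam * a)) * exp (- (real (2 * CARD('n)) * ln (1 + norm x)))"
      by (simp flip: exp_add)
    also have "exp (- (real (2 * CARD('n)) * ln (1 + norm x))) = inverse ((1 + norm x) ^ (2 * CARD('n)))"
      by (simp only: exp_minus exp_of_nat_mult) (simp add: add_pos_nonneg)
    also have "\<dots> = (\<Prod>i\<in>(Basis :: (real^'n) set). inverse ((1 + norm x)\<^sup>2))"
      by (simp add: power_mult power_inverse)
    also have "\<dots> \<le> (\<Prod>i\<in>Basis. inverse (1 + (x \<bullet> i)\<^sup>2))"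
    proof (rule prod_mono, rule conjI)
      fix i :: "real^'n" assume "i \<in> Basis"
      then have "\<bar>x \<bullet> i\<bar>\<^sup>2 \<le> (norm x)\<^sup>2"
        by (intro power_mono Basis_le_norm) auto
      then have "1 + (x \<bullet> i)\<^sup>2 \<le> (1 + norm x)\<^sup>2"
        by (simp add: power2_sum add_increasing2)
      then show "inverse ((1 + norm x)\<^sup>2) \<le> inverse (1 + (x \<bullet> i)\<^sup>2)"
        by (intro le_imp_inverse_le) (auto intro: add_pos_nonneg)
    qed simp
    finally show ?thesis by simp
  qed
  show "integrable lborel (\<lambda>x::real^'n. exp (- (lam * \<omega> (norm x))))"
  proof (rule Bochner_Integration.integrable_bound[OF int])
    have "continuous_on UNIV (\<lambda>x::real^'n. exp (- (lam * \<omega> (norm x))))"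
      by (intro continuous_intros continuous_on_weight[OF w])
    then show "(\<lambda>x::real^'n. exp (- (lam * \<omega> (norm x)))) \<in> borel_measurable lborel"
      by (simp add: borel_measurable_continuous_onI)
    show "AE x::real^'n in lborel. norm (exp (- (lam * \<omega> (norm x))))
        \<le> norm (exp (- (lam * a)) * (\<Prod>i\<in>Basis. inverse (1 + (x \<bullet> i)\<^sup>2)))"
      using le by (auto intro!: AE_I2 order_trans[OF le abs_ge_self] simp del: abs_mult)
  qed
qed

lemma S_omegaD:
  fixes f :: "real^'n::finite \<Rightarrow> complex"
  assumes "f \<in> S_omega \<omega>"
  shows "integrable lborel f" "continuous_on UNIV f" "continuous_on UNIV (fourier f)"
    "0 < lam \<Longrightarrow> Lp_norm \<infinity> (\<lambda>x. exp (lam * \<omega> (norm x)) *\<^sub>R f x) < \<infinity>"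
    "0 < lam \<Longrightarrow> Lp_norm \<infinity> (\<lambda>x. exp (lam * \<omega> (norm x)) *\<^sub>R fourier f x) < \<infinity>"
proof -
  \<comment> \<open>The empty index list yields the function itself, so the bounds and the
    continuity of order zero can be read off.\<close>
  have nil: "iterated_partial [] h = h" for h :: "real^'n \<Rightarrow> complex"
    by (simp add: iterated_partial_def)
  show "integrable lborel f"
    using assms by (simp add: S_omega_def)
  have "smooth f" "smooth (fourier f)"
    using assms by (simp_all add: S_omega_def)
  then show "continuous_on UNIV f" "continuous_on UNIV (fourier f)"
    unfolding smooth_def using nil by metis+
  show "0 < lam \<Longrightarrow> Lp_norm \<infinity> (\<lambda>x. exp (lam * \<omega> (norm x)) *\<^sub>R f x) < \<infinity>"
    "0 < lam \<Longrightarrow> Lp_norm \<infinity> (\<lambda>x. exp (lam * \<omega> (norm x)) *\<^sub>R fourier f x) < \<infinity>"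
    using assms unfolding S_omega_def mem_Collect_eq by (metis nil)+
qed

lemma weighted_sup_bound:
  fixes h :: "real^'n::finite \<Rightarrow> complex"
  assumes w: "weight_function \<omega> K b" and h: "continuous_on UNIV h"
    and fin: "Lp_norm \<infinity> (\<lambda>x. exp (lam * \<omega> (norm x)) *\<^sub>R h x) < \<infinity>"
  obtains C where "\<And>x. cmod (h x) \<le> C * exp (- (lam * \<omega> (norm x)))"
proof -
  obtain C where C: "Lp_norm \<infinity> (\<lambda>x. exp (lam * \<omega> (norm x)) *\<^sub>R h x) = ennreal C" "0 \<le> C"
    using fin by (cases "Lp_norm \<infinity> (\<lambda>x. exp (lam * \<omega> (norm x)) *\<^sub>R h x)") auto
  have cont: "continuous_on UNIV (\<lambda>x. exp (lam * \<omega> (norm x)) *\<^sub>R h x)"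
    by (intro continuous_intros h continuous_on_weight[OF w])
  have "exp (lam * \<omega> (norm x)) * cmod (h x) \<le> C" for x
    using le_Lp_norm_infinity[OF cont, of x] C by simp
  then have "cmod (h x) \<le> C * exp (- (lam * \<omega> (norm x)))" for x
    by (simp add: exp_minus field_simps)
  then show ?thesis by (rule that)
qed

text \<open>The weighted bound on \<open>f\<close> with exponent 1 gives boundedness; the one on
  \<open>fourier f\<close>, with the exponent from \<open>integrable_exp_weight\<close>, gives
  integrability.\<close>

lemma S_omega_fourier_invertible:
  fixes f :: "real^'n::finite \<Rightarrow> complex"
  assumes w: "weight_function \<omega> K b" and f: "f \<in> S_omega \<omega>"
  shows "fourier_invertible f"
proof -
  note f' = S_omegaD[OF f]
  have "bounded (range f)"
  proof -
    obtain C where C: "\<And>x. cmod (f x) \<le> C * exp (- (1 * \<omega> (norm x)))"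
      using weighted_sup_bound[OF w f'(2) f'(4)[of 1]] by auto
    \<comment> \<open>The sign of \<open>C\<close> is not part of \<open>weighted_sup_bound\<close>;
      the bound at the origin shows that it is nonnegative.\<close>
    have "0 \<le> C * exp (- (1 * \<omega> (norm (0 :: real^'n))))"
      by (rule order_trans[OF norm_ge_zero C])
    then have "0 \<le> C" by (simp add: zero_le_mult_iff)
    then have "C * exp (- (1 * \<omega> (norm x))) \<le> C" for x :: "real^'n"
      using weight_nonneg[OF w, of x] by (intro mult_left_le) auto
    then show ?thesis
      using C by (auto simp: bounded_iff intro: order_trans)
  qed
  moreover have "integrable lborel (fourier f)"
  proof -
    obtain lam where lam: "0 < lam" "integrable lborel (\<lambda>x::real^'n. exp (- (lam * \<omega> (norm x))))"
      by (rule integrable_exp_weight[OF w])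
    obtain C where C: "\<And>x. cmod (fourier f x) \<le> C * exp (- (lam * \<omega> (norm x)))"
      using weighted_sup_bound[OF w f'(3) f'(5)[OF lam(1)]] by blast
    show ?thesis
    proof (rule Bochner_Integration.integrable_bound)
      show "integrable lborel (\<lambda>x::real^'n. C * exp (- (lam * \<omega> (norm x))))"
        using lam by simp
      show "fourier f \<in> borel_measurable lborel"
        using f'(3) by (simp add: borel_measurable_continuous_onI)
      show "AE x in lborel. cmod (fourier f x) \<le> norm (C * exp (- (lam * \<omega> (norm x))))"
        using order_trans[OF C abs_ge_self] by simp
    qed
  qed
  ultimately show ?thesis
    using f' by (simp add: fourier_invertible_def)
qed

section \<open>The two estimates\<close>

lemma rihaczek_measurable:
  fixes f :: "real^'n::finite \<Rightarrow> complex"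
  assumes "continuous_on UNIV f" "continuous_on UNIV (fourier f)"
  shows "rihaczek f \<in> borel_measurable borel"
proof -
  have "continuous_on UNIV (\<lambda>z. f (fst z))" "continuous_on UNIV (\<lambda>z. fourier f (snd z))"
    by (auto intro!: continuous_on_compose2[OF assms(1)] continuous_on_compose2[OF assms(2)] continuous_intros)
  then have "continuous_on UNIV (\<lambda>z. exp (- (\<i> * complex_of_real (fst z \<bullet> snd z))) * f (fst z) * cnj (fourier f (snd z)))"
    by (intro continuous_intros)
  then show ?thesis
    by (intro borel_measurable_continuous_onI) (simp add: rihaczek_def case_prod_beta')
qed

text \<open>Each application costs a factor \<open>exp (K * lam)\<close> and multiplies the exponent
  by \<open>K\<close>.\<close>

lemma exp_weight_add_le:
  assumes w: "weight_function \<omega> K b" and "0 \<le> s" "0 \<le> t" "0 \<le> r" "r \<le> s + t" "0 \<le> lam"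
  shows "exp (lam * \<omega> r) \<le> exp (K * lam) * exp (K * lam * \<omega> s) * exp (K * lam * \<omega> t)"
proof -
  have "lam * \<omega> r \<le> lam * (K * (1 + \<omega> s + \<omega> t))"
    using weight_add[OF w] assms by (intro mult_left_mono) auto
  then show ?thesis
    by (simp add: algebra_simps flip: exp_add)
qed

text \<open>The weight at \<open>z\<close> is split between \<open>y\<close> and
  \<open>y - z\<close> inside the integral of \<open>spectrogram_le\<close>. Hoelder's inequality
  and translation invariance then give a bound independent of \<open>z\<close>.\<close>

lemma spectrogram_weighted_le:
  fixes f g :: "real^'n::finite \<Rightarrow> complex"
  assumes w: "weight_function \<omega> K b" and f: "f \<in> S_omega \<omega>" and g: "g \<in> S_omega \<omega>"
    and p: "1 \<le> p" and lam: "0 \<le> lam"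
  shows "Lp_norm \<infinity> (\<lambda>z. exp (lam * \<omega> (norm z)) *\<^sub>R spectrogram g f z)
        \<le> ennreal (exp (K * (1 + 2 * K) * lam) / (2 * pi) ^ CARD('n))
          * Lp_norm p (\<lambda>z. exp (2 * K\<^sup>2 * lam * \<omega> (norm z)) *\<^sub>R rihaczek f z)
          * Lp_norm (conj_exponent p) (\<lambda>z. exp (2 * K\<^sup>2 * lam * \<omega> (norm z)) *\<^sub>R rihaczek g z)"
proof -
  note nf = S_omega_fourier_invertible[OF w f] and ng = S_omega_fourier_invertible[OF w g]
  note [measurable] = fourier_invertibleD(5)[OF nf] fourier_invertibleD(5)[OF ng]
    rihaczek_measurable[OF S_omegaD(2,3)[OF f]] rihaczek_measurable[OF S_omegaD(2,3)[OF g]]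
    borel_measurable_continuous_onI[OF continuous_on_weight[OF w]]
  define c where "c = (2 * pi) ^ CARD('n)"
  have c: "0 < c" by (simp add: c_def)
  define D where "D = exp (K * (1 + 2 * K) * lam)"
  define u :: "(real^'n \<Rightarrow> complex) \<Rightarrow> (real^'n) \<times> (real^'n) \<Rightarrow> complex"
    where "u = (\<lambda>h z. exp (2 * K\<^sup>2 * lam * \<omega> (norm z)) *\<^sub>R rihaczek h z)"
  have [measurable]: "u f \<in> borel_measurable borel" "u g \<in> borel_measurable borel"
    unfolding u_def by measurable
  have K: "1 \<le> K" using w by (simp add: weight_function_def)
  \<comment> \<open>Splitting the weight once, along \<open>z = y - (y - z)\<close>, produces the
    coefficient \<open>K\<close> throughout; since \<open>1 \<le> K\<close>, it is at most the
    coefficients in the statement.\<close>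
  have KK: "K \<le> K * (1 + 2 * K)" "K \<le> 2 * K\<^sup>2"
    using K mult_mono[of 1 K K K] by (simp_all add: power2_eq_square distrib_left)
  have weight: "exp (lam * \<omega> (norm z)) \<le> D * exp (2 * K\<^sup>2 * lam * \<omega> (norm y)) * exp (2 * K\<^sup>2 * lam * \<omega> (norm (y - z)))"
    for y z :: "(real^'n) \<times> (real^'n)"
  proof -
    have "exp (lam * \<omega> (norm z)) \<le> exp (K * lam) * exp (K * lam * \<omega> (norm y)) * exp (K * lam * \<omega> (norm (y - z)))"
      using norm_triangle_ineq4[of y "y - z"] by (intro exp_weight_add_le[OF w _ _ _ _ lam]) auto
    also have "\<dots> \<le> D * exp (2 * K\<^sup>2 * lam * \<omega> (norm y)) * exp (2 * K\<^sup>2 * lam * \<omega> (norm (y - z)))"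
      unfolding D_def using KK lam weight_nonneg[OF w]
      by (intro mult_mono) (auto intro!: mult_right_mono)
    finally show ?thesis .
  qed
  have pointwise: "ennreal (exp (lam * \<omega> (norm z)) * spectrogram g f z)
      \<le> ennreal (D / c) * Lp_norm p (u f) * Lp_norm (conj_exponent p) (u g)" for z
  proof -
    let ?e = "exp (lam * \<omega> (norm z))"
    have "ennreal c * ennreal (?e * spectrogram g f z) = ennreal ?e * ennreal (c * spectrogram g f z)"
      using c by (simp add: spectrogram_def mult_ac flip: ennreal_mult)
    also have "\<dots> \<le> ennreal ?e * (\<integral>\<^sup>+y. cmod (rihaczek f y) * cmod (rihaczek g (y - z)) \<partial>lborel)"
      unfolding c_def by (intro mult_left_mono spectrogram_le nf ng) simp
    also have "\<dots> = (\<integral>\<^sup>+y. ennreal (?e * (cmod (rihaczek f y) * cmod (rihaczek g (y - z)))) \<partial>lborel)"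
      by (subst nn_integral_cmult[symmetric]) (simp_all add: ennreal_mult)
    also have "\<dots> \<le> (\<integral>\<^sup>+y. ennreal D * ennreal (norm (u f y) * norm (u g (y - z))) \<partial>lborel)"
    proof (intro nn_integral_mono)
      fix y
      have "?e * (cmod (rihaczek f y) * cmod (rihaczek g (y - z))) \<le>
         D * exp (2 * K\<^sup>2 * lam * \<omega> (norm y)) * exp (2 * K\<^sup>2 * lam * \<omega> (norm (y - z))) *
           (cmod (rihaczek f y) * cmod (rihaczek g (y - z)))"
        by (intro mult_right_mono weight) simp
      also have "\<dots> = D * (norm (u f y) * norm (u g (y - z)))"
        by (simp add: u_def mult_ac)
      finally show "ennreal (?e * (cmod (rihaczek f y) * cmod (rihaczek g (y - z)))) \<le> ennreal D * ennreal (norm (u f y) * norm (u g (y - z)))"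
        by (simp add: D_def ennreal_leI flip: ennreal_mult)
    qed
    also have "\<dots> = ennreal D * (\<integral>\<^sup>+y. norm (u f y) * norm (u g (y - z)) \<partial>lborel)"
      by (rule nn_integral_cmult) measurable
    also have "\<dots> \<le> ennreal D * (Lp_norm p (u f) * Lp_norm (conj_exponent p) (\<lambda>y. u g (y - z)))"
      by (intro mult_left_mono Lp_norm_Holder p) simp_all
    also have "\<dots> \<le> ennreal D * (Lp_norm p (u f) * Lp_norm (conj_exponent p) (u g))"
      by (intro mult_left_mono Lp_norm_translate_le) simp_all
    also have "\<dots> = ennreal c * (ennreal (D / c) * Lp_norm p (u f) * Lp_norm (conj_exponent p) (u g))"
      using c by (simp add: D_def mult.assoc[symmetric] flip: ennreal_mult)
    finally show ?thesis
      using c by (simp add: ennreal_mult_le_mult_iff)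
  qed
  have meas: "(\<lambda>z. exp (lam * \<omega> (norm z)) *\<^sub>R spectrogram g f z) \<in> borel_measurable borel"
    unfolding spectrogram_def by measurable
  have "Lp_norm \<infinity> (\<lambda>z. exp (lam * \<omega> (norm z)) *\<^sub>R spectrogram g f z)
      \<le> ennreal (D / c) * Lp_norm p (u f) * Lp_norm (conj_exponent p) (u g)"
    by (rule Lp_norm_infinity_le[OF meas]) (use pointwise in \<open>simp add: spectrogram_def\<close>)
  then show ?thesis
    by (simp only: D_def c_def u_def)
qed

section \<open>The Rihaczek form bounded by the spectrogram\<close>

text \<open>The map \<pi> stands for either projection of phase space, so that positions and
  frequencies are treated at once. The weight at \<open>x\<close> is split between \<open>z\<close>
  and \<open>x - \<pi> z\<close>; the second part is absorbed by the weighted supremum of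
  \<open>h\<close>, which is a pointwise bound by continuity.\<close>

lemma weighted_convolution_le:
  fixes V :: "'a::euclidean_space \<Rightarrow> real" and \<pi> :: "'a \<Rightarrow> 'b::euclidean_space" and h :: "'b \<Rightarrow> complex"
  assumes w: "weight_function \<omega> K b" and h: "continuous_on UNIV h" and lam: "0 \<le> lam"
    and [measurable]: "V \<in> borel_measurable borel" and V: "\<And>z. 0 \<le> V z"
    and \<pi>: "\<And>z. norm (\<pi> z) \<le> norm z" and \<pi>_cont: "continuous_on UNIV \<pi>"
  shows "ennreal (exp (lam * \<omega> (norm x))) * (\<integral>\<^sup>+z. V z * cmod (h (x - \<pi> z)) \<partial>lborel)
    \<le> ennreal (exp (K * lam)) * Lp_norm \<infinity> (\<lambda>x. exp (K * lam * \<omega> (norm x)) *\<^sub>R h x)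
       * (\<integral>\<^sup>+z. V z * exp (K * lam * \<omega> (norm z)) \<partial>lborel)"
proof -
  let ?e = "exp (lam * \<omega> (norm x))"
  let ?G = "Lp_norm \<infinity> (\<lambda>x. exp (K * lam * \<omega> (norm x)) *\<^sub>R h x)"
  have [measurable]: "\<pi> \<in> borel_measurable borel" "h \<in> borel_measurable borel"
    using \<pi>_cont h by (auto intro: borel_measurable_continuous_onI)
  note [measurable] = borel_measurable_continuous_onI[OF continuous_on_weight[OF w]]
  have K: "1 \<le> K" using w by (simp add: weight_function_def)
  have sup: "ennreal (exp (K * lam * \<omega> (norm y)) * cmod (h y)) \<le> ?G" for y
  proof -
    have "continuous_on UNIV (\<lambda>x. exp (K * lam * \<omega> (norm x)) *\<^sub>R h x)"
      by (intro continuous_intros h continuous_on_weight[OF w])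
    from le_Lp_norm_infinity[OF this, of y] show ?thesis by simp
  qed
  have "ennreal ?e * (\<integral>\<^sup>+z. V z * cmod (h (x - \<pi> z)) \<partial>lborel)
      = (\<integral>\<^sup>+z. ennreal (?e * (V z * cmod (h (x - \<pi> z)))) \<partial>lborel)"
    using V by (subst nn_integral_cmult[symmetric]) (simp_all add: ennreal_mult)
  also have "\<dots> \<le> (\<integral>\<^sup>+z. (ennreal (exp (K * lam)) * ?G) * ennreal (V z * exp (K * lam * \<omega> (norm z))) \<partial>lborel)"
  proof (intro nn_integral_mono)
    fix z
    let ?h = "exp (K * lam * \<omega> (norm (x - \<pi> z))) * cmod (h (x - \<pi> z))"
    have "norm x \<le> norm z + norm (x - \<pi> z)"
      using norm_triangle_ineq[of "\<pi> z" "x - \<pi> z"] \<pi>[of z] by simp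
    then have "?e \<le> exp (K * lam) * exp (K * lam * \<omega> (norm z)) * exp (K * lam * \<omega> (norm (x - \<pi> z)))"
      by (intro exp_weight_add_le[OF w _ _ _ _ lam]) auto
    then have "?e * (V z * cmod (h (x - \<pi> z)))
      \<le> exp (K * lam) * exp (K * lam * \<omega> (norm z)) * exp (K * lam * \<omega> (norm (x - \<pi> z))) * (V z * cmod (h (x - \<pi> z)))"
      using V by (intro mult_right_mono) auto
    also have "\<dots> = exp (K * lam) * ?h * (V z * exp (K * lam * \<omega> (norm z)))"
      by (simp add: mult_ac)
    finally have "ennreal (?e * (V z * cmod (h (x - \<pi> z)))) \<le> ennreal (exp (K * lam)) * ennreal ?h * ennreal (V z * exp (K * lam * \<omega> (norm z)))"
      using V by (simp add: ennreal_leI flip: ennreal_mult)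
    also have "\<dots> \<le> ennreal (exp (K * lam)) * ?G * ennreal (V z * exp (K * lam * \<omega> (norm z)))"
      by (intro mult_right_mono mult_left_mono sup) auto
    finally show "ennreal (?e * (V z * cmod (h (x - \<pi> z)))) \<le> ennreal (exp (K * lam)) * ?G * ennreal (V z * exp (K * lam * \<omega> (norm z)))" .
  qed
  also have "\<dots> = ennreal (exp (K * lam)) * ?G * (\<integral>\<^sup>+z. V z * exp (K * lam * \<omega> (norm z)) \<partial>lborel)"
    by (rule nn_integral_cmult) measurable
  finally show ?thesis .
qed

text \<open>The modulus of the Rihaczek form is a product of one value of \<open>f\<close> and one
  of \<open>fourier f\<close>. Both are controlled by the same weighted integral \<open>I\<close> of
  the short-time transform, so \<open>I\<^sup>2\<close> appears, and Hoelder's inequality bounds it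
  by the spectrogram.\<close>

lemma rihaczek_weighted_le:
  fixes f g :: "real^'n::finite \<Rightarrow> complex"
  assumes w: "weight_function \<omega> K b" and f: "f \<in> S_omega \<omega>" and g: "g \<in> S_omega \<omega>"
    and g0: "g \<noteq> (\<lambda>x. 0)" and p: "1 \<le> p" and lam: "0 \<le> lam"
  shows "Lp_norm \<infinity> (\<lambda>z. exp (lam * \<omega> (norm z)) *\<^sub>R rihaczek f z)
        \<le> ennreal (exp (K * (1 + 2 * K) * lam))
          * Lp_norm \<infinity> (\<lambda>x. exp (K\<^sup>2 * lam * \<omega> (norm x)) *\<^sub>R g x)
          * Lp_norm \<infinity> (\<lambda>\<xi>. exp (K\<^sup>2 * lam * \<omega> (norm \<xi>)) *\<^sub>R fourier g \<xi>)
          * (Lp_norm (conj_exponent (2 * p))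
               (\<lambda>z :: (real^'n) \<times> (real^'n). exp (- \<mu> * \<omega> (norm z))))\<^sup>2
          / (ennreal ((2 * pi) ^ (2 * CARD('n))) * Lp_norm 2 g ^ 4)
          * Lp_norm p (\<lambda>z. exp (2 * (K\<^sup>2 * lam + \<mu>) * \<omega> (norm z)) *\<^sub>R spectrogram g f z)"
proof -
  note nf = S_omega_fourier_invertible[OF w f] and ng = S_omega_fourier_invertible[OF w g]
  note [measurable] = fourier_invertibleD(5)[OF nf] fourier_invertibleD(5)[OF ng] rihaczek_measurable[OF S_omegaD(2,3)[OF f]]
    borel_measurable_continuous_onI[OF continuous_on_weight[OF w]]
  define c where "c = (2 * pi) ^ CARD('n)"
  have c: "0 < c" by (simp add: c_def)
  have K: "1 \<le> K" using w by (simp add: weight_function_def)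
  define V where "V = (\<lambda>z. cmod (stft g f z))"
  have V [measurable]: "V \<in> borel_measurable borel"
    unfolding V_def by measurable
  define I where "I = (\<integral>\<^sup>+z. V z * exp (K\<^sup>2 * lam * \<omega> (norm z)) \<partial>lborel)"
  define G where "G = Lp_norm \<infinity> (\<lambda>x. exp (K\<^sup>2 * lam * \<omega> (norm x)) *\<^sub>R g x)"
  define G' where "G' = Lp_norm \<infinity> (\<lambda>\<xi>. exp (K\<^sup>2 * lam * \<omega> (norm \<xi>)) *\<^sub>R fourier g \<xi>)"
  define L where "L = Lp_norm p (\<lambda>z. exp (2 * (K\<^sup>2 * lam + \<mu>) * \<omega> (norm z)) *\<^sub>R spectrogram g f z)"
  define M where "M = Lp_norm (conj_exponent (2 * p)) (\<lambda>z :: (real^'n) \<times> (real^'n). exp (- \<mu> * \<omega> (norm z)))"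
  define D where "D = exp (K * (1 + 2 * K) * lam)"
  define s where "s = (\<integral>y. (cmod (g y))\<^sup>2 \<partial>lborel)"
  have S: "(\<integral>\<^sup>+y. (cmod (g y))\<^sup>2 \<partial>lborel) = ennreal s"
    unfolding s_def by (rule nn_integral_eq_integral) (simp_all add: integrable_square ng)
  \<comment> \<open>A continuous \<open>g\<close> that vanishes almost everywhere vanishes
    identically; positivity of \<open>s\<close> later permits division by it.\<close>
  have s: "0 < s"
  proof (rule ccontr)
    assume "\<not> 0 < s"
    then have "(\<integral>\<^sup>+y. (cmod (g y))\<^sup>2 \<partial>lborel) = 0"
      using S by (simp add: ennreal_neg)
    then have "AE y in lborel. cmod (g y) \<le> 0"
      by (subst (asm) nn_integral_0_iff_AE) auto
    then have "cmod (g y) \<le> 0" for y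
      by (intro AE_continuous_le[where h = "\<lambda>y. cmod (g y)"] continuous_intros fourier_invertibleD(3)[OF ng])
    with g0 show False by auto
  qed
  \<comment> \<open>The weight is split twice, first between \<open>x\<close> and \<xi> and then
    inside each integral, which accounts for the square of \<open>K\<close>.\<close>
  have KK: "K * (K * lam) = K\<^sup>2 * lam"
    by (simp add: power2_eq_square)
  have Klam: "0 \<le> K * lam" using K lam by simp
  have proj_le: "norm (fst z) \<le> norm z" "norm (snd z) \<le> norm z" for z :: "(real^'n) \<times> (real^'n)"
    by (metis norm_fst_le norm_snd_le prod.collapse)+
  have bound_f: "ennreal (exp (K * lam * \<omega> (norm x)) * (c * cmod (f x) * s)) \<le> ennreal (exp (K\<^sup>2 * lam)) * G * I" for x
  proof -
    have "ennreal (exp (K * lam * \<omega> (norm x)) * (c * cmod (f x) * s))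
       = ennreal (exp (K * lam * \<omega> (norm x))) * (ennreal (c * cmod (f x)) * ennreal s)"
      using c s by (simp flip: ennreal_mult)
    also have "\<dots> \<le> ennreal (exp (K * lam * \<omega> (norm x))) * (\<integral>\<^sup>+z. V z * cmod (g (x - fst z)) \<partial>lborel)"
      unfolding c_def V_def S[symmetric] by (intro mult_left_mono cmod_le_stft nf ng) simp
    also have "\<dots> \<le> ennreal (exp (K\<^sup>2 * lam)) * G * I"
      using weighted_convolution_le[OF w fourier_invertibleD(3)[OF ng] Klam V, of fst x]
      unfolding KK G_def I_def by (simp add: V_def proj_le continuous_on_fst)
    finally show ?thesis .
  qed
  have bound_Ff: "ennreal (exp (K * lam * \<omega> (norm \<xi>)) * (c * cmod (fourier f \<xi>) * s)) \<le> ennreal (exp (K\<^sup>2 * lam)) * G' * I" for \<xi>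
  proof -
    have "ennreal (exp (K * lam * \<omega> (norm \<xi>)) * (c * cmod (fourier f \<xi>) * s))
       = ennreal (exp (K * lam * \<omega> (norm \<xi>))) * (ennreal (c * cmod (fourier f \<xi>)) * ennreal s)"
      using c s by (simp flip: ennreal_mult)
    also have "\<dots> \<le> ennreal (exp (K * lam * \<omega> (norm \<xi>))) * (\<integral>\<^sup>+z. V z * cmod (fourier g (\<xi> - snd z)) \<partial>lborel)"
      unfolding c_def V_def S[symmetric] by (intro mult_left_mono cmod_fourier_le_stft nf ng) simp
    also have "\<dots> \<le> ennreal (exp (K\<^sup>2 * lam)) * G' * I"
      using weighted_convolution_le[OF w S_omegaD(3)[OF g] Klam V, of snd \<xi>]
      unfolding KK G'_def I_def by (simp add: V_def proj_le continuous_on_snd)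
    finally show ?thesis .
  qed
  have I: "I\<^sup>2 \<le> L * M\<^sup>2"
  proof -
    \<comment> \<open>The factor with exponent \<mu> is inserted here and compensated by
      \<open>exp (- \<mu> * \<omega> (norm z))\<close>, whose norm is \<open>M\<close>.\<close>
    let ?h = "\<lambda>z. exp ((K\<^sup>2 * lam + \<mu>) * \<omega> (norm z)) * V z"
    have p2: "1 \<le> 2 * p"
      using p by (simp add: mult_2 add_increasing)
    have "I = (\<integral>\<^sup>+z. norm (?h z) * norm (exp (- \<mu> * \<omega> (norm z))) \<partial>lborel)"
      unfolding I_def
    proof (intro nn_integral_cong arg_cong[where f = ennreal])
      fix z :: "(real^'n) \<times> (real^'n)"
      have "exp ((K\<^sup>2 * lam + \<mu>) * \<omega> (norm z)) * exp (- \<mu> * \<omega> (norm z)) = exp (K\<^sup>2 * lam * \<omega> (norm z))"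
        by (simp add: distrib_right flip: exp_add)
      then show "V z * exp (K\<^sup>2 * lam * \<omega> (norm z)) = norm (?h z) * norm (exp (- \<mu> * \<omega> (norm z)))"
        by (simp add: V_def mult_ac)
    qed
    also have "\<dots> \<le> Lp_norm (2 * p) ?h * M"
      unfolding M_def by (intro Lp_norm_Holder p2) measurable
    finally have "I\<^sup>2 \<le> (Lp_norm (2 * p) ?h * M)\<^sup>2"
      by (rule power_mono) simp
    also have "\<dots> = (Lp_norm (2 * p) ?h)\<^sup>2 * M\<^sup>2"
      by (rule power_mult_distrib)
    also have "\<dots> \<le> Lp_norm p (\<lambda>z. (?h z)\<^sup>2) * M\<^sup>2"
      by (intro mult_right_mono Lp_norm_square_le p) simp_all
    also have "(\<lambda>z. (?h z)\<^sup>2) = (\<lambda>z. exp (2 * (K\<^sup>2 * lam + \<mu>) * \<omega> (norm z)) *\<^sub>R spectrogram g f z)"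
      by (simp only: V_def spectrogram_def power_mult_distrib real_scaleR_def mult.assoc exp_double)
    finally show ?thesis by (simp add: L_def)
  qed
  have pointwise: "ennreal (exp (lam * \<omega> (norm z)) * cmod (rihaczek f z)) * ((ennreal c)\<^sup>2 * (ennreal s)\<^sup>2)
      \<le> ennreal D * G * G' * M\<^sup>2 * L" for z
  proof -
    define x \<xi> where "x = fst z" and "\<xi> = snd z"
    have "exp (lam * \<omega> (norm z)) \<le> exp (K * lam) * exp (K * lam * \<omega> (norm x)) * exp (K * lam * \<omega> (norm \<xi>))"
      unfolding x_def \<xi>_def
      using norm_Pair_le[of "fst z" "snd z"] by (intro exp_weight_add_le[OF w _ _ _ _ lam]) auto
    then have "exp (lam * \<omega> (norm z)) * (cmod (rihaczek f z) * (c\<^sup>2 * s\<^sup>2))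
        \<le> exp (K * lam) * exp (K * lam * \<omega> (norm x)) * exp (K * lam * \<omega> (norm \<xi>)) * (cmod (rihaczek f z) * (c\<^sup>2 * s\<^sup>2))"
      by (intro mult_right_mono) auto
    also have "\<dots> = exp (K * lam) * ((exp (K * lam * \<omega> (norm x)) * (c * cmod (f x) * s))
       * (exp (K * lam * \<omega> (norm \<xi>)) * (c * cmod (fourier f \<xi>) * s)))"
      by (simp add: cmod_rihaczek x_def \<xi>_def power2_eq_square mult_ac)
    finally have "ennreal (exp (lam * \<omega> (norm z)) * (cmod (rihaczek f z) * (c\<^sup>2 * s\<^sup>2)))
      \<le> ennreal (exp (K * lam)) * (ennreal (exp (K * lam * \<omega> (norm x)) * (c * cmod (f x) * s))
       * ennreal (exp (K * lam * \<omega> (norm \<xi>)) * (c * cmod (fourier f \<xi>) * s)))"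
      using c s by (simp add: ennreal_leI flip: ennreal_mult)
    also have "\<dots> \<le> ennreal (exp (K * lam)) * ((ennreal (exp (K\<^sup>2 * lam)) * G * I) * (ennreal (exp (K\<^sup>2 * lam)) * G' * I))"
      by (intro mult_left_mono mult_mono bound_f bound_Ff) auto
    also have "\<dots> = ennreal (exp (K * lam) * exp (K\<^sup>2 * lam) * exp (K\<^sup>2 * lam)) * G * G' * I\<^sup>2"
      by (simp add: ennreal_mult power2_eq_square mult_ac)
    \<comment> \<open>One factor comes from splitting the weight between \<open>x\<close> and \<xi>,
      and one from each of \<open>bound_f\<close> and \<open>bound_Ff\<close>; the exponents add up
      to \<open>K * (1 + 2 * K) * lam\<close>.\<close>
    also have "exp (K * lam) * exp (K\<^sup>2 * lam) * exp (K\<^sup>2 * lam) = D"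
      by (simp add: D_def power2_eq_square algebra_simps flip: exp_add)
    also have "ennreal D * G * G' * I\<^sup>2 \<le> ennreal D * G * G' * (L * M\<^sup>2)"
      by (intro mult_left_mono I) simp
    finally show ?thesis
      using c s by (simp add: ennreal_mult ennreal_power mult_ac)
  qed
  \<comment> \<open>The denominator of the constant. It is nonzero and finite, so multiplication by
    it can be undone by division in \<open>ennreal\<close>.\<close>
  define T where "T = (ennreal c)\<^sup>2 * (ennreal s)\<^sup>2"
  have T: "T = ennreal ((2 * pi) ^ (2 * CARD('n))) * Lp_norm 2 g ^ 4"
  proof -
    have "c\<^sup>2 = (2 * pi) ^ (2 * CARD('n))"
      unfolding c_def by (simp only: mult.commute[of 2 "CARD('n)"] power_mult)
    then show ?thesis
      using c s S by (simp only: T_def Lp_norm_2_power4 ennreal_power less_imp_le)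
  qed
  have T0: "T \<noteq> 0" "T \<noteq> top"
    using c s by (auto simp: T_def ennreal_power ennreal_mult_eq_top_iff)
  have meas: "(\<lambda>z. exp (lam * \<omega> (norm z)) *\<^sub>R rihaczek f z) \<in> borel_measurable borel"
    by measurable
  have "Lp_norm \<infinity> (\<lambda>z. exp (lam * \<omega> (norm z)) *\<^sub>R rihaczek f z) \<le> ennreal D * G * G' * M\<^sup>2 / T * L"
  proof (rule Lp_norm_infinity_le[OF meas], rule AE_I2)
    fix z
    have "ennreal (exp (lam * \<omega> (norm z)) * cmod (rihaczek f z)) * T / T \<le> ennreal D * G * G' * M\<^sup>2 * L / T"
      unfolding T_def by (intro divide_right_mono_ennreal pointwise)
    also have "\<dots> = ennreal D * G * G' * M\<^sup>2 / T * L"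
      by (simp only: ennreal_divide_times ennreal_times_divide)
    finally show "ennreal (norm (exp (lam * \<omega> (norm z)) *\<^sub>R rihaczek f z)) \<le> ennreal D * G * G' * M\<^sup>2 / T * L"
      by (simp only: mult_divide_eq_ennreal[OF T0]) simp
  qed
  then show ?thesis
    by (simp only: T D_def G_def G'_def M_def L_def)
qed

theorem theorem3p1:
  fixes \<omega> :: "real \<Rightarrow> real" and K b :: real
    and g :: "real^'n::finite \<Rightarrow> complex" and p :: ennreal
  assumes "weight_function \<omega> K b"
    and "g \<in> S_omega \<omega>" and "g \<noteq> (\<lambda>x. 0)"
    and "1 \<le> p"
  shows
    "(\<forall>lam\<ge>0. \<forall>f\<in>S_omega \<omega>.
        Lp_norm \<infinity> (\<lambda>z. exp (lam * \<omega> (norm z)) *\<^sub>R spectrogram g f z)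
        \<le> ennreal (exp (K * (1 + 2 * K) * lam) / (2 * pi) ^ CARD('n))
          * Lp_norm p (\<lambda>z. exp (2 * K\<^sup>2 * lam * \<omega> (norm z)) *\<^sub>R rihaczek f z)
          * Lp_norm (conj_exponent p) (\<lambda>z. exp (2 * K\<^sup>2 * lam * \<omega> (norm z)) *\<^sub>R rihaczek g z))
     \<and>
     (\<forall>lam\<ge>0. \<forall>\<mu> > 2 * real CARD('n) / (b * enn2real (conj_exponent (2 * p))). \<forall>f\<in>S_omega \<omega>.
        Lp_norm \<infinity> (\<lambda>z. exp (lam * \<omega> (norm z)) *\<^sub>R rihaczek f z)
        \<le> ennreal (exp (K * (1 + 2 * K) * lam))
          * Lp_norm \<infinity> (\<lambda>x. exp (K\<^sup>2 * lam * \<omega> (norm x)) *\<^sub>R g x)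
          * Lp_norm \<infinity> (\<lambda>\<xi>. exp (K\<^sup>2 * lam * \<omega> (norm \<xi>)) *\<^sub>R fourier g \<xi>)
          * (Lp_norm (conj_exponent (2 * p))
               (\<lambda>z :: (real^'n) \<times> (real^'n). exp (- \<mu> * \<omega> (norm z))))\<^sup>2
          / (ennreal ((2 * pi) ^ (2 * CARD('n))) * Lp_norm 2 g ^ 4)
          * Lp_norm p (\<lambda>z. exp (2 * (K\<^sup>2 * lam + \<mu>) * \<omega> (norm z)) *\<^sub>R spectrogram g f z))"
  using spectrogram_weighted_le[OF assms(1) _ assms(2,4)] rihaczek_weighted_le[OF assms(1) _ assms(2-4)]
  by blast

end
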